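(* Let $X$ be a first-countable, causally simple Lorentzian pre-length space (with curves understood as continuous curves), or a causally simple, metric-compatible KS-Lorentzian pre-length space (with curves understood as locally Lipschitz continuous curves). If $X$ is timelike Cauchy complete, then it satisfies Condition B.
   Context: An extended time separation function on a set $X$ is a map $\ell:X\times X\to\{-\infty\}\cup[0,\infty]$ with $\ell(x,x)\ge0$ and $\ell(x,y)+\ell(y,z)\le\ell(x,z)$ for all $x,y,z$ (convention $-\infty+\infty=-\infty$). Put $d=\max(0,\ell)$ (Lorentzian distance); $x\le y$ iff $\ell(x,y)\ge0$; $x\ll y$ iff $d(x,y)>0$; $J^+(x)=\{y:x\le y\}$, $J^-(x)=\{y:y\le x\}$, $I^+(x)=\{y:x\ll y\}$, $I^-(x)=\{y:y\ll x\}$. A Lorentzian pre-length space is such a pair $(X,\ell)$ with a topology on $X$ for which all $I^\pm(x)$ are open. It is causally simple if $\le$ is antisymmetric and all $J^\pm(x)$ are closed. A curve is a continuous map from an interval $I\subset\mathbb{R}$ to $X$; it is causal (timelike) if $t<s$ implies $\gamma(t)\le\gamma(s)$ ($\gamma(t)\ll\gamma(s)$). A KS-Lorentzian pre-length space is a Lorentzian pre-length space with a metric $\rho$ inducing its topology such that $d$ is lower semicontinuous; in this setting all curves (also in the definitions below) are required to be locally Lipschitz with respect to $\rho$. It is metric-compatible if every $x\in X$ has a neighborhood $U$ and a constant $C>0$ such that every causal curve contained in $U$ has $\rho$-arclength at most $C$. A causal curve $\gamma:I\to X$ is future extendible if there exist an order-preserving homeomorphism $\varphi:I\to\hat I$ onto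 an interval, an interval $\tilde I\supset\hat I$ containing some $t$ with $t>s$ for all $s\in\hat I$, and a causal curve $\tilde\gamma:\tilde I\to X$ with $\tilde\gamma|_{\hat I}=\gamma\circ\varphi^{-1}$; otherwise it is future inextendible. The past versions are analogous. A timelike curve is future (past) inextendible if it is so as a causal curve. Timelike Cauchy complete: every sequence $(x_j)$ in $X$ converges in $X$ provided that either $x_j\ll x_{j+1}$ for all $j$ and $\sup_k d(x_j,x_{j+k})\to0$ as $j\to\infty$, or $x_{j+1}\ll x_j$ for all $j$ and $\sup_k d(x_{j+k},x_j)\to0$ as $j\to\infty$. Condition B: for every future inextendible timelike curve $\gamma:I\to X$, if $d(\gamma(t_0),\gamma(\cdot))$ is bounded on $[t_0,\infty)\cap I$ for some $t_0\in I$, then $\sup I\in I$; and for every past inextendible timelike curve $\gamma:I\to X$, if $d(\gamma(\cdot),\gamma(t_0))$ is bounded on $(-\infty,t_0]\cap I$ for some $t_0\in I$, then $\inf I\in I$. *)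

theory Defs
  imports "HOL-Analysis.Analysis"
begin

(* Addition with -\<infinity> absorbing; the library addition on ereal has
   -\<infinity> + \<infinity> = \<infinity> instead. *)
definition tsep_plus :: "ereal \<Rightarrow> ereal \<Rightarrow> ereal" where
  "tsep_plus a b = (if a = -\<infinity> \<or> b = -\<infinity> then -\<infinity> else a + b)"

definition time_separation :: "'a set \<Rightarrow> ('a \<Rightarrow> 'a \<Rightarrow> ereal) \<Rightarrow> bool" where
  "time_separation X l \<longleftrightarrow>
     (\<forall>x\<in>X. \<forall>y\<in>X. l x y = -\<infinity> \<or> 0 \<le> l x y) \<and>
     (\<forall>x\<in>X. 0 \<le> l x x) \<and>
     (\<forall>x\<in>X. \<forall>y\<in>X. \<forall>z\<in>X. tsep_plus (l x y) (l y z) \<le> l x z)"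

definition lor_dist :: "('a \<Rightarrow> 'a \<Rightarrow> ereal) \<Rightarrow> 'a \<Rightarrow> 'a \<Rightarrow> ereal" where
  "lor_dist l x y = max 0 (l x y)"

definition causal_rel :: "('a \<Rightarrow> 'a \<Rightarrow> ereal) \<Rightarrow> 'a \<Rightarrow> 'a \<Rightarrow> bool" where
  "causal_rel l x y \<longleftrightarrow> 0 \<le> l x y"

definition chron_rel :: "('a \<Rightarrow> 'a \<Rightarrow> ereal) \<Rightarrow> 'a \<Rightarrow> 'a \<Rightarrow> bool" where
  "chron_rel l x y \<longleftrightarrow> 0 < lor_dist l x y"

definition causal_future :: "'a set \<Rightarrow> ('a \<Rightarrow> 'a \<Rightarrow> ereal) \<Rightarrow> 'a \<Rightarrow> 'a set" where
  "causal_future X l x = {y \<in> X. causal_rel l x y}"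

definition causal_past :: "'a set \<Rightarrow> ('a \<Rightarrow> 'a \<Rightarrow> ereal) \<Rightarrow> 'a \<Rightarrow> 'a set" where
  "causal_past X l x = {y \<in> X. causal_rel l y x}"

definition chron_future :: "'a set \<Rightarrow> ('a \<Rightarrow> 'a \<Rightarrow> ereal) \<Rightarrow> 'a \<Rightarrow> 'a set" where
  "chron_future X l x = {y \<in> X. chron_rel l x y}"

definition chron_past :: "'a set \<Rightarrow> ('a \<Rightarrow> 'a \<Rightarrow> ereal) \<Rightarrow> 'a \<Rightarrow> 'a set" where
  "chron_past X l x = {y \<in> X. chron_rel l y x}"

(* The underlying set X of the space is the carrier topspace T of its topology. *)
definition lorentzian_pre_length_space :: "'a topology \<Rightarrow> ('a \<Rightarrow> 'a \<Rightarrow> ereal) \<Rightarrow> bool" where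
  "lorentzian_pre_length_space T l \<longleftrightarrow>
     time_separation (topspace T) l \<and>
     (\<forall>x\<in>topspace T. openin T (chron_future (topspace T) l x) \<and>
                      openin T (chron_past (topspace T) l x))"

definition causally_simple :: "'a topology \<Rightarrow> ('a \<Rightarrow> 'a \<Rightarrow> ereal) \<Rightarrow> bool" where
  "causally_simple T l \<longleftrightarrow>
     antisymp_on (topspace T) (causal_rel l) \<and>
     (\<forall>x\<in>topspace T. closedin T (causal_future (topspace T) l x) \<and>
                      closedin T (causal_past (topspace T) l x))"

definition KS_lorentzian_pre_length_space ::
    "'a topology \<Rightarrow> 'a metric \<Rightarrow> ('a \<Rightarrow> 'a \<Rightarrow> ereal) \<Rightarrow> bool" where
  "KS_lorentzian_pre_length_space T \<rho> l \<longleftrightarrow>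
     lorentzian_pre_length_space T l \<and>
     mtopology_of \<rho> = T \<and>
     (\<forall>a. openin (prod_topology T T)
            {p \<in> topspace (prod_topology T T). a < lor_dist l (fst p) (snd p)})"

definition continuous_curve :: "'a topology \<Rightarrow> real set \<Rightarrow> (real \<Rightarrow> 'a) \<Rightarrow> bool" where
  "continuous_curve T I \<gamma> \<longleftrightarrow>
     is_interval I \<and> I \<noteq> {} \<and> continuous_map (top_of_set I) T \<gamma>"

definition lipschitz_curve :: "'a metric \<Rightarrow> real set \<Rightarrow> (real \<Rightarrow> 'a) \<Rightarrow> bool" where
  "lipschitz_curve \<rho> I \<gamma> \<longleftrightarrow>
     continuous_curve (mtopology_of \<rho>) I \<gamma> \<and>
     (\<forall>t\<in>I. \<exists>e>0. Lipschitz_continuous_map (submetric euclidean_metric (I \<inter> ball t e)) \<rho> \<gamma>)"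

(* From here on the argument K is the class of admissible curves: K I \<gamma> says that \<gamma>,
   restricted to I, is a curve with domain I. It is instantiated by continuous_curve T or by
   lipschitz_curve \<rho>. *)
definition causal_curve ::
    "(real set \<Rightarrow> (real \<Rightarrow> 'a) \<Rightarrow> bool) \<Rightarrow> ('a \<Rightarrow> 'a \<Rightarrow> ereal) \<Rightarrow> real set \<Rightarrow> (real \<Rightarrow> 'a) \<Rightarrow> bool" where
  "causal_curve K l I \<gamma> \<longleftrightarrow>
     K I \<gamma> \<and> (\<forall>t\<in>I. \<forall>s\<in>I. t < s \<longrightarrow> causal_rel l (\<gamma> t) (\<gamma> s))"

definition timelike_curve ::
    "(real set \<Rightarrow> (real \<Rightarrow> 'a) \<Rightarrow> bool) \<Rightarrow> ('a \<Rightarrow> 'a \<Rightarrow> ereal) \<Rightarrow> real set \<Rightarrow> (real \<Rightarrow> 'a) \<Rightarrow> bool" where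
  "timelike_curve K l I \<gamma> \<longleftrightarrow>
     K I \<gamma> \<and> (\<forall>t\<in>I. \<forall>s\<in>I. t < s \<longrightarrow> chron_rel l (\<gamma> t) (\<gamma> s))"

(* The map \<psi> is the inverse of the reparametrization \<phi>. *)
definition future_extendible ::
    "(real set \<Rightarrow> (real \<Rightarrow> 'a) \<Rightarrow> bool) \<Rightarrow> ('a \<Rightarrow> 'a \<Rightarrow> ereal) \<Rightarrow> real set \<Rightarrow> (real \<Rightarrow> 'a) \<Rightarrow> bool" where
  "future_extendible K l I \<gamma> \<longleftrightarrow>
     (\<exists>I1 \<phi> \<psi> I2 \<gamma>'. is_interval I1 \<and> homeomorphism I I1 \<phi> \<psi> \<and> strict_mono_on I \<phi> \<and>
        is_interval I2 \<and> I1 \<subseteq> I2 \<and> (\<exists>t\<in>I2. \<forall>s\<in>I1. s < t) \<and>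
        causal_curve K l I2 \<gamma>' \<and> (\<forall>s\<in>I1. \<gamma>' s = \<gamma> (\<psi> s)))"

definition past_extendible ::
    "(real set \<Rightarrow> (real \<Rightarrow> 'a) \<Rightarrow> bool) \<Rightarrow> ('a \<Rightarrow> 'a \<Rightarrow> ereal) \<Rightarrow> real set \<Rightarrow> (real \<Rightarrow> 'a) \<Rightarrow> bool" where
  "past_extendible K l I \<gamma> \<longleftrightarrow>
     (\<exists>I1 \<phi> \<psi> I2 \<gamma>'. is_interval I1 \<and> homeomorphism I I1 \<phi> \<psi> \<and> strict_mono_on I \<phi> \<and>
        is_interval I2 \<and> I1 \<subseteq> I2 \<and> (\<exists>t\<in>I2. \<forall>s\<in>I1. t < s) \<and>
        causal_curve K l I2 \<gamma>' \<and> (\<forall>s\<in>I1. \<gamma>' s = \<gamma> (\<psi> s)))"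

definition arclength :: "'a metric \<Rightarrow> real set \<Rightarrow> (real \<Rightarrow> 'a) \<Rightarrow> ereal" where
  "arclength \<rho> I \<gamma> =
     (SUP ts \<in> {ts. sorted ts \<and> set ts \<subseteq> I}.
        ereal (\<Sum>i<length ts - 1. mdist \<rho> (\<gamma> (ts ! i)) (\<gamma> (ts ! Suc i))))"

definition metric_compatible :: "'a metric \<Rightarrow> ('a \<Rightarrow> 'a \<Rightarrow> ereal) \<Rightarrow> bool" where
  "metric_compatible \<rho> l \<longleftrightarrow>
     (\<forall>x\<in>mspace \<rho>. \<exists>U V C. openin (mtopology_of \<rho>) V \<and> x \<in> V \<and> V \<subseteq> U \<and> U \<subseteq> mspace \<rho> \<and>
        0 < C \<and>
        (\<forall>I \<gamma>. causal_curve (lipschitz_curve \<rho>) l I \<gamma> \<and> \<gamma> ` I \<subseteq> U \<longrightarrow>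
                arclength \<rho> I \<gamma> \<le> ereal C))"

definition timelike_Cauchy_complete :: "'a topology \<Rightarrow> ('a \<Rightarrow> 'a \<Rightarrow> ereal) \<Rightarrow> bool" where
  "timelike_Cauchy_complete T l \<longleftrightarrow>
     (\<forall>x :: nat \<Rightarrow> 'a. range x \<subseteq> topspace T \<and>
        ((\<forall>j. chron_rel l (x j) (x (Suc j))) \<and>
           (\<lambda>j. SUP k. lor_dist l (x j) (x (j + k))) \<longlonglongrightarrow> 0 \<or>
         (\<forall>j. chron_rel l (x (Suc j)) (x j)) \<and>
           (\<lambda>j. SUP k. lor_dist l (x (j + k)) (x j)) \<longlonglongrightarrow> 0)
        \<longrightarrow> (\<exists>p. limitin T x p sequentially))"

(* Supremum and infimum of I are taken in the extended reals, so that sup I \<in> I fails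
   when I is unbounded above. *)
definition condition_B ::
    "(real set \<Rightarrow> (real \<Rightarrow> 'a) \<Rightarrow> bool) \<Rightarrow> ('a \<Rightarrow> 'a \<Rightarrow> ereal) \<Rightarrow> bool" where
  "condition_B K l \<longleftrightarrow>
     (\<forall>I \<gamma>. timelike_curve K l I \<gamma> \<and> \<not> future_extendible K l I \<gamma> \<and>
        (\<exists>t0\<in>I. \<exists>C::real. \<forall>s\<in>{t0..} \<inter> I. lor_dist l (\<gamma> t0) (\<gamma> s) \<le> ereal C)
        \<longrightarrow> Sup (ereal ` I) \<in> ereal ` I) \<and>
     (\<forall>I \<gamma>. timelike_curve K l I \<gamma> \<and> \<not> past_extendible K l I \<gamma> \<and>
        (\<exists>t0\<in>I. \<exists>C::real. \<forall>s\<in>{..t0} \<inter> I. lor_dist l (\<gamma> s) (\<gamma> t0) \<le> ereal C)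
        \<longrightarrow> Inf (ereal ` I) \<in> ereal ` I)"

end

theory Submission
  imports Defs
begin

text \<open>
  Let \<open>\<gamma>\<close> be a timelike curve on \<open>I\<close> with \<open>sup I \<notin> I\<close> and bounded distance from \<open>\<gamma> t0\<close>. Along a
  sequence \<open>s j\<close> increasing to \<open>sup I\<close> the distances from \<open>\<gamma> t0\<close> are increasing and bounded, so by
  the reverse triangle inequality \<open>\<gamma> (s j)\<close> is a timelike Cauchy sequence and converges. Closedness
  of the causal futures and pasts makes any two limits of such sequences causally related in both
  directions, hence equal by antisymmetry, so \<open>\<gamma> t\<close> converges to a point \<open>p\<close> in the causal future of
  the whole curve. Adding \<open>p\<close> as an endpoint, after compressing the parameter by \<open>arctan\<close>, extends
  \<open>\<gamma>\<close>.

  For locally Lipschitz curves, metric compatibility at \<open>p\<close> bounds the arclength of a final segment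
  of \<open>\<gamma>\<close>, and the parameter is \<open>arctan\<close> plus that arclength. The arclength makes the extended curve
  1-Lipschitz up to the endpoint, and \<open>arctan\<close> makes the inverse reparametrization locally
  Lipschitz. The past half follows by reversing both \<open>l\<close> and the parameter.
\<close>

section \<open>The endpoint\<close>

text \<open>On causally related pairs \<open>l\<close> is nonnegative, so \<open>lor_dist\<close>
  agrees with \<open>l\<close> and \<open>tsep_plus\<close> with ordinary addition. This is the
  reverse triangle inequality in the form in which it is used.\<close>

lemma lor_dist_add_le:
  assumes "time_separation X l" "x \<in> X" "y \<in> X" "z \<in> X" "causal_rel l x y" "causal_rel l y z"
  shows "lor_dist l x y + lor_dist l y z \<le> lor_dist l x z"
proof -
  have "tsep_plus (l x y) (l y z) \<le> l x z"
    using assms by (auto simp: time_separation_def)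
  then show ?thesis
    using assms(5,6) unfolding causal_rel_def lor_dist_def tsep_plus_def
    by (auto simp: max_def split: if_splits)
qed

lemma causal_rel_if_chron_rel: "chron_rel l x y \<Longrightarrow> causal_rel l x y"
  by (auto simp: chron_rel_def lor_dist_def causal_rel_def max_def split: if_splits)

lemma exists_gt_if_Sup_notin:
  fixes I :: "real set"
  assumes "Sup (ereal ` I) \<notin> ereal ` I" "t \<in> I"
  shows "\<exists>t'\<in>I. t < t'"
proof -
  have "ereal t < Sup (ereal ` I)"
    using assms by (metis SUP_upper imageI order_le_less)
  then show ?thesis by (auto simp: less_SUP_iff)
qed

text \<open>A countable sequence in \<open>I\<close> realizes the supremum; recursively choosing
  points beyond both the previous choice and the next term of that sequence stays cofinal. The
  predicate \<open>P\<close> allows each choice to be made in a prescribed cofinal set, such as the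
  parameters where a curve is outside a neighbourhood.\<close>

lemma strict_cofinal_sequence:
  fixes I :: "real set"
  assumes sup: "Sup (ereal ` I) \<notin> ereal ` I" and "t0 \<in> I"
    and P: "\<And>t. t \<in> I \<Longrightarrow> \<exists>t'\<in>I. t \<le> t' \<and> P t'"
  shows "\<exists>s :: nat \<Rightarrow> real. strict_mono s \<and> (\<forall>n. s n \<in> I \<and> t0 < s n \<and> P (s n)) \<and>
    (\<forall>t\<in>I. \<exists>n. t < s n)"
proof -
  obtain f :: "nat \<Rightarrow> ereal" where f: "range f \<subseteq> ereal ` I" "Sup (ereal ` I) = (SUP i. f i)"
    using Sup_countable_SUP[of "ereal ` I"] \<open>t0 \<in> I\<close> by blast
  then have "\<forall>n. \<exists>r\<in>I. f n = ereal r" by blast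
  then obtain r where r: "\<And>n. r n \<in> I" "\<And>n. f n = ereal (r n)" by metis
  \<comment> \<open>\<open>P\<close> only provides a point at or after a given one; moving first to
    some \<open>t\<close> strictly beyond \<open>max a b\<close> makes the inequalities
    strict.\<close>
  have above: "\<exists>t'\<in>I. a < t' \<and> b < t' \<and> P t'" if ab: "a \<in> I" "b \<in> I" for a b
  proof -
    have "max a b \<in> I" using ab by (simp add: max_def)
    then obtain t where "t \<in> I" "max a b < t"
      using exists_gt_if_Sup_notin[OF sup] by blast
    moreover obtain t' where "t' \<in> I" "t \<le> t'" "P t'" using P[OF \<open>t \<in> I\<close>] by blast
    ultimately show ?thesis by (intro bexI[of _ t']) auto
  qed
  \<comment> \<open>The invariant \<open>r n < s n\<close> is what makes \<open>s\<close> cofinal in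
    \<open>I\<close>.\<close>
  have "\<exists>s. \<forall>n. (s n \<in> I \<and> t0 < s n \<and> r n < s n \<and> P (s n)) \<and> s n < s (Suc n)"
  proof (rule dependent_nat_choice)
    show "\<exists>x. x \<in> I \<and> t0 < x \<and> r 0 < x \<and> P x"
      using above[OF \<open>t0 \<in> I\<close> r(1)] by blast
    show "\<exists>y. (y \<in> I \<and> t0 < y \<and> r (Suc n) < y \<and> P y) \<and> x < y"
      if "x \<in> I \<and> t0 < x \<and> r n < x \<and> P x" for x n
      using above[of x "r (Suc n)"] that r(1) by force
  qed
  then obtain s where s: "\<And>n. s n \<in> I \<and> t0 < s n \<and> r n < s n \<and> P (s n)" "\<And>n. s n < s (Suc n)"
    by blast
  show ?thesis
  proof (intro exI[of _ s] conjI ballI)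
    show "strict_mono s" using s(2) by (simp add: strict_mono_Suc_iff)
    show "\<exists>n. t < s n" if "t \<in> I" for t
    proof -
      have "ereal t < Sup (ereal ` I)"
        using sup that by (metis SUP_upper imageI order_le_less)
      then obtain n where "ereal t < f n" using f(2) by (auto simp: less_SUP_iff)
      then have "t < r n" using r(2) by simp
      with s(1)[of n] show ?thesis by (auto intro!: exI[of _ n])
    qed
  qed (use s(1) in auto)
qed

text \<open>The numbers \<open>a n\<close>, the distances from \<open>q\<close> to
  \<open>x n\<close>, increase to a finite limit \<open>L\<close>. The reverse triangle inequality
  bounds the distance from \<open>x j\<close> to \<open>x (j + k)\<close> by \<open>L - a j\<close>
  for every \<open>k\<close> at once, which is the Cauchy condition.\<close>

lemma chron_sequence_converges:
  assumes ts: "time_separation (topspace T) l" and complete: "timelike_Cauchy_complete T l"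
    and q: "q \<in> topspace T" and x: "\<And>n::nat. x n \<in> topspace T"
    and chron: "\<And>m n. m < n \<Longrightarrow> chron_rel l (x m) (x n)"
    and q_chron: "\<And>n. chron_rel l q (x n)"
    and bound: "\<And>n. lor_dist l q (x n) \<le> ereal C"
  shows "\<exists>p. limitin T x p sequentially"
proof -
  note causal = causal_rel_if_chron_rel
  \<comment> \<open>The supremum in the Cauchy condition includes \<open>k = 0\<close>, where
    chronology of distinct terms says nothing.\<close>
  have refl: "causal_rel l (x n) (x n)" for n
    using ts x by (auto simp: time_separation_def causal_rel_def)
  have add: "lor_dist l q (x j) + lor_dist l (x j) (x (j + k)) \<le> lor_dist l q (x (j + k))" for j k
    using lor_dist_add_le[OF ts q x x causal[OF q_chron], of j "j + k"] chron[of j "j + k"] refl[of j]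
    by (cases k) (auto intro: causal)
  have nonneg: "0 \<le> lor_dist l u v" for u v by (simp add: lor_dist_def)
  \<comment> \<open>The conversion loses nothing, since the values lie between 0 and
    \<open>C\<close>.\<close>
  define a where "a n = real_of_ereal (lor_dist l q (x n))" for n
  have a: "lor_dist l q (x n) = ereal (a n)" for n
    using bound[of n] nonneg[of q "x n"] unfolding a_def
    by (cases "lor_dist l q (x n)") auto
  have mono: "a j \<le> a (j + k)" for j k
  proof -
    have "lor_dist l q (x j) \<le> lor_dist l q (x j) + lor_dist l (x j) (x (j + k))"
      using nonneg by (simp add: ereal_le_add_self)
    with add[of j k] show ?thesis unfolding a by (metis ereal_less_eq(3) order_trans)
  qed
  then have "incseq a" by (simp add: incseq_def) (metis le_add_diff_inverse)
  moreover have "a n \<le> C" for n using bound[of n] a by simp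
  ultimately obtain L where L: "a \<longlonglongrightarrow> L" "\<And>n. a n \<le> L"
    using incseq_convergent[of a C] by blast
  have "(\<lambda>j. SUP k. lor_dist l (x j) (x (j + k))) \<longlonglongrightarrow> 0"
  proof (rule tendsto_sandwich)
    show "\<forall>\<^sub>F j in sequentially. 0 \<le> (SUP k. lor_dist l (x j) (x (j + k)))"
      by (rule always_eventually) (auto intro: SUP_upper2 nonneg)
    have "lor_dist l (x j) (x (j + k)) \<le> ereal (L - a j)" for j k
    proof -
      have "ereal (a j) + lor_dist l (x j) (x (j + k)) \<le> ereal L"
        using add[of j k] L(2)[of "j + k"] unfolding a by (metis ereal_less_eq(3) order_trans)
      then show ?thesis by (cases "lor_dist l (x j) (x (j + k))") auto
    qed
    then show "\<forall>\<^sub>F j in sequentially. (SUP k. lor_dist l (x j) (x (j + k))) \<le> ereal (L - a j)"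
      by (intro always_eventually allI SUP_least)
    have "(\<lambda>j. L - a j) \<longlonglongrightarrow> 0" using tendsto_diff[OF tendsto_const L(1), of L] by simp
    then show "(\<lambda>j. ereal (L - a j)) \<longlonglongrightarrow> 0" by (simp add: zero_ereal_def)
  qed auto
  moreover have "\<forall>j. chron_rel l (x j) (x (Suc j))" using chron by simp
  ultimately show ?thesis
    using complete x unfolding timelike_Cauchy_complete_def by (meson image_subsetI)
qed

text \<open>Every cofinal increasing sequence of parameters has a limit along the curve. Such a
  limit lies above the whole curve and below every point that does, so all these limits agree by
  antisymmetry; convergence in the full parameter then follows by contradiction.\<close>

lemma timelike_curve_endpoint:
  assumes ts: "time_separation (topspace T) l" and simple: "causally_simple T l"
    and complete: "timelike_Cauchy_complete T l"
    and \<gamma>: "\<And>t. t \<in> I \<Longrightarrow> \<gamma> t \<in> topspace T"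
    and chron: "\<And>t s. \<lbrakk>t \<in> I; s \<in> I; t < s\<rbrakk> \<Longrightarrow> chron_rel l (\<gamma> t) (\<gamma> s)"
    and t0: "t0 \<in> I" and bound: "\<And>s. \<lbrakk>s \<in> I; t0 \<le> s\<rbrakk> \<Longrightarrow> lor_dist l (\<gamma> t0) (\<gamma> s) \<le> ereal C"
    and sup: "Sup (ereal ` I) \<notin> ereal ` I"
  shows "\<exists>p\<in>topspace T. (\<forall>t\<in>I. causal_rel l (\<gamma> t) p) \<and>
    (\<forall>U. openin T U \<and> p \<in> U \<longrightarrow> (\<exists>t1\<in>I. \<forall>t\<in>I. t1 \<le> t \<longrightarrow> \<gamma> t \<in> U))"
proof -
  \<comment> \<open>A tail of the sequence lies in the closed causal future of each
    \<open>\<gamma> t\<close>, hence so does the limit. The free \<open>P\<close> lets the sequences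
    from \<open>strict_cofinal_sequence\<close> be fed in as they come.\<close>
  have limit: "\<exists>p. limitin T (\<gamma> \<circ> s) p sequentially \<and> (\<forall>t\<in>I. causal_rel l (\<gamma> t) p)"
    if "strict_mono s" "\<forall>n. s n \<in> I \<and> t0 < s n \<and> P (s n)" "\<forall>t\<in>I. \<exists>n. t < s n"
    for P and s :: "nat \<Rightarrow> real"
  proof -
    from that have s: "strict_mono s" "\<And>n. s n \<in> I" "\<And>n. t0 < s n" "\<And>t. t \<in> I \<Longrightarrow> \<exists>n. t < s n"
      by auto
    have "\<exists>p. limitin T (\<gamma> \<circ> s) p sequentially"
    proof (rule chron_sequence_converges[OF ts complete \<gamma>[OF t0]])
      show "lor_dist l (\<gamma> t0) ((\<gamma> \<circ> s) n) \<le> ereal C" for n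
        using bound s(2,3) by (simp add: less_imp_le)
    qed (use s t0 \<gamma> chron in \<open>auto simp: strict_mono_less\<close>)
    then obtain p where p: "limitin T (\<gamma> \<circ> s) p sequentially" ..
    have "causal_rel l (\<gamma> t) p" if t: "t \<in> I" for t
    proof -
      obtain N where "t < s N" using s(4)[OF t] by blast
      then have "t < s n" if "n \<ge> N" for n
        using s(1) that by (meson less_le_trans strict_mono_less_eq)
      then have "(\<gamma> \<circ> s) n \<in> causal_future (topspace T) l (\<gamma> t)" if "n \<ge> N" for n
        using that causal_rel_if_chron_rel[OF chron[OF t s(2)]] \<gamma>[OF s(2)]
        by (simp add: causal_future_def)
      then have "\<forall>\<^sub>F n in sequentially. (\<gamma> \<circ> s) n \<in> causal_future (topspace T) l (\<gamma> t)"
        by (rule eventually_sequentiallyI)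
      moreover have "closedin T (causal_future (topspace T) l (\<gamma> t))"
        using simple \<gamma>[OF t] by (simp add: causally_simple_def)
      ultimately have "p \<in> causal_future (topspace T) l (\<gamma> t)"
        using limitin_closedin[OF p] by simp
      then show ?thesis by (simp add: causal_future_def)
    qed
    with p show ?thesis by blast
  qed
  \<comment> \<open>Dually, the sequence lies in the closed causal past of
    \<open>p'\<close>.\<close>
  have limit_le: "causal_rel l p p'"
    if "limitin T (\<gamma> \<circ> s) p sequentially" "\<forall>n. s n \<in> I \<and> t0 < s n \<and> P (s n)" "\<forall>t\<in>I. causal_rel l (\<gamma> t) p'"
      "p' \<in> topspace T" for s :: "nat \<Rightarrow> real" and p p' P
  proof -
    have "p \<in> causal_past (topspace T) l p'"
      using that simple \<gamma>
      by (intro limitin_closedin[OF that(1)]) (auto simp: causally_simple_def causal_past_def)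
    then show ?thesis by (simp add: causal_past_def)
  qed
  obtain s :: "nat \<Rightarrow> real" where s: "strict_mono s" "\<forall>n. s n \<in> I \<and> t0 < s n \<and> True"
      "\<forall>t\<in>I. \<exists>n. t < s n"
    using strict_cofinal_sequence[OF sup t0, of "\<lambda>_. True"] by auto
  obtain p where p: "limitin T (\<gamma> \<circ> s) p sequentially" "\<forall>t\<in>I. causal_rel l (\<gamma> t) p"
    using limit[OF s] by blast
  have p_top: "p \<in> topspace T" using p(1) by (rule limitin_topspace)
  show ?thesis
  proof (intro bexI[of _ p] conjI allI impI)
    fix U assume U: "openin T U \<and> p \<in> U"
    show "\<exists>t1\<in>I. \<forall>t\<in>I. t1 \<le> t \<longrightarrow> \<gamma> t \<in> U"
    \<comment> \<open>Otherwise a cofinal sequence stays outside \<open>U\<close>. Its limit must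
      again be \<open>p\<close>, so it would have to enter \<open>U\<close>.\<close>
    proof (rule ccontr)
      assume "\<not> ?thesis"
      then have "\<exists>t'\<in>I. t \<le> t' \<and> \<gamma> t' \<notin> U" if "t \<in> I" for t using that by blast
      then obtain s' :: "nat \<Rightarrow> real" where s': "strict_mono s'" "\<forall>n. s' n \<in> I \<and> t0 < s' n \<and> \<gamma> (s' n) \<notin> U"
          "\<forall>t\<in>I. \<exists>n. t < s' n"
        using strict_cofinal_sequence[OF sup t0, of "\<lambda>t. \<gamma> t \<notin> U"] by blast
      obtain p' where p': "limitin T (\<gamma> \<circ> s') p' sequentially" "\<forall>t\<in>I. causal_rel l (\<gamma> t) p'"
        using limit[OF s'] by blast
      have "p' \<in> topspace T" using p'(1) by (rule limitin_topspace)
      then have "p = p'"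
        using simple limit_le[OF p(1) s(2) p'(2)] limit_le[OF p'(1) s'(2) p(2)] p_top
        by (auto simp: causally_simple_def antisymp_on_def)
      with p'(1) U s'(2) show False by (auto simp: limitin_def)
    qed
  qed (use p p_top in auto)
qed

section \<open>Extension to the endpoint\<close>

text \<open>The part common to both classes of curves: a bounded increasing reparametrization
  \<open>\<phi>\<close> leaves room for a finite parameter \<open>b\<close> at which
  \<open>p\<close> is attached. Membership of the extended curve in the class \<open>K\<close> is
  left to the caller, who may use the properties of \<open>\<gamma>'\<close> listed in the
  hypothesis \<open>K\<close>.\<close>

lemma future_extendible_if_endpoint:
  fixes I :: "real set" and \<phi> :: "real \<Rightarrow> real" and p :: 'a
  defines "b \<equiv> Sup (\<phi> ` I)"
  assumes curve: "continuous_curve T I \<gamma>"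
    and causal: "\<And>t s. \<lbrakk>t \<in> I; s \<in> I; t < s\<rbrakk> \<Longrightarrow> causal_rel l (\<gamma> t) (\<gamma> s)"
    and sup: "Sup (ereal ` I) \<notin> ereal ` I"
    and p: "p \<in> topspace T" "\<And>t. t \<in> I \<Longrightarrow> causal_rel l (\<gamma> t) p"
      "\<And>U. \<lbrakk>openin T U; p \<in> U\<rbrakk> \<Longrightarrow> \<exists>t1\<in>I. \<forall>t\<in>I. t1 \<le> t \<longrightarrow> \<gamma> t \<in> U"
    and \<phi>: "strict_mono_on I \<phi>" "continuous_on I \<phi>" "bdd_above (\<phi> ` I)"
    and K: "\<And>\<psi> \<gamma>'. \<lbrakk>homeomorphism I (\<phi> ` I) \<phi> \<psi>; continuous_curve T (insert b (\<phi> ` I)) \<gamma>'; \<gamma>' b = p;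
      \<And>t. t \<in> I \<Longrightarrow> \<phi> t < b; \<And>t. t \<in> I \<Longrightarrow> \<gamma>' (\<phi> t) = \<gamma> t\<rbrakk> \<Longrightarrow> K (insert b (\<phi> ` I)) \<gamma>'"
  shows "future_extendible K l I \<gamma>"
proof -
  have I: "is_interval I" "I \<noteq> {}" and \<gamma>: "continuous_map (top_of_set I) T \<gamma>"
    using curve by (auto simp: continuous_curve_def)
  have \<gamma>_top: "\<gamma> t \<in> topspace T" if "t \<in> I" for t
    using \<gamma> that by (auto simp: continuous_map_def Pi_iff)
  have inj: "inj_on \<phi> I" using \<phi>(1) by (rule strict_mono_on_imp_inj_on)
  \<comment> \<open>The supremum is not attained because \<open>I\<close> has no greatest element
    and \<open>\<phi>\<close> is strictly increasing.\<close>
  have less_b: "\<phi> t < b" if t: "t \<in> I" for t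
  proof -
    obtain t' where "t' \<in> I" "t < t'" using exists_gt_if_Sup_notin[OF sup t] by blast
    then have "\<phi> t < \<phi> t'" "\<phi> t' \<le> b"
      using \<phi> t by (auto simp: strict_mono_on_def b_def intro: cSup_upper)
    then show ?thesis by simp
  qed
  have near_b: "\<exists>t\<in>I. x < \<phi> t" if "x < b" for x
    using that I(2) \<phi>(3) unfolding b_def by (auto simp: less_cSup_iff)
  obtain \<psi> where hom: "homeomorphism I (\<phi> ` I) \<phi> \<psi>"
    using homeomorphism_into_1d[of I \<phi> "\<phi> ` I"] I(1) \<phi>(2) inj
    by (auto simp: is_interval_path_connected_1)
  then have \<psi>: "\<psi> (\<phi> t) = t" if "t \<in> I" for t using that by (auto simp: homeomorphism_def)
  have J1: "is_interval (\<phi> ` I)"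
    using I(1) \<phi>(2) by (simp add: is_interval_connected_1 connected_continuous_image)
  have J2: "is_interval (insert b (\<phi> ` I))"
    unfolding is_interval_1
  proof (intro ballI allI impI)
    fix u v x assume uv: "u \<in> insert b (\<phi> ` I)" "v \<in> insert b (\<phi> ` I)" "u \<le> x \<and> x \<le> v"
    show "x \<in> insert b (\<phi> ` I)"
    proof (cases "x < b")
      case True
      then obtain t where "t \<in> I" "x < \<phi> t" using near_b by blast
      moreover have "u \<in> \<phi> ` I" using uv True by auto
      ultimately show ?thesis using J1 uv(3) unfolding is_interval_1 by (metis imageI insertI2 less_imp_le)
    next
      case False
      then show ?thesis using uv less_b by force
    qed
  qed
  define \<gamma>' where "\<gamma>' u = (if u = b then p else \<gamma> (\<psi> u))" for u
  have \<gamma>'_b: "\<gamma>' b = p" by (simp add: \<gamma>'_def)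
  have \<gamma>'_\<phi>: "\<gamma>' (\<phi> t) = \<gamma> t" if "t \<in> I" for t
    using less_b[OF that] \<psi>[OF that] by (simp add: \<gamma>'_def)
  \<comment> \<open>Removing the single last point leaves an open subset, so preimages that are open
    in the old domain remain open in the new one.\<close>
  have J1_open: "openin (top_of_set (insert b (\<phi> ` I))) (\<phi> ` I)"
    unfolding openin_open using less_b by (intro exI[of _ "{..<b}"]) auto
  have "continuous_map (top_of_set (insert b (\<phi> ` I))) T \<gamma>'"
    unfolding continuous_map_def
  proof (intro conjI allI impI)
    show "\<gamma>' \<in> topspace (top_of_set (insert b (\<phi> ` I))) \<rightarrow> topspace T"
      using \<gamma>'_b \<gamma>'_\<phi> p(1) \<gamma>_top by auto
    fix U assume U: "openin T U"
    have "continuous_map (top_of_set (\<phi> ` I)) (top_of_set I) \<psi>"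
      using hom by (auto simp: homeomorphism_def)
    then have "continuous_map (top_of_set (\<phi> ` I)) T (\<gamma> \<circ> \<psi>)"
      using \<gamma> by (rule continuous_map_compose)
    then have "openin (top_of_set (\<phi> ` I)) {u \<in> \<phi> ` I. (\<gamma> \<circ> \<psi>) u \<in> U}"
      using U by (auto simp: continuous_map_def)
    also have "{u \<in> \<phi> ` I. (\<gamma> \<circ> \<psi>) u \<in> U} = {u \<in> \<phi> ` I. \<gamma>' u \<in> U}"
      using \<gamma>'_\<phi> \<psi> by auto
    finally have open1: "openin (top_of_set (insert b (\<phi> ` I))) {u \<in> \<phi> ` I. \<gamma>' u \<in> U}"
      using J1_open by (rule openin_trans)
    show "openin (top_of_set (insert b (\<phi> ` I)))
        {u \<in> topspace (top_of_set (insert b (\<phi> ` I))). \<gamma>' u \<in> U}"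
    proof (cases "p \<in> U")
      \<comment> \<open>Here the preimage also contains \<open>b\<close>, together with the whole
        segment beyond \<open>\<phi> t1\<close>; that segment is a neighbourhood of \<open>b\<close>
        in the new domain.\<close>
      case True
      then obtain t1 where t1: "t1 \<in> I" "\<And>t. \<lbrakk>t \<in> I; t1 \<le> t\<rbrakk> \<Longrightarrow> \<gamma> t \<in> U" using p(3)[OF U] by blast
      have "openin (top_of_set (insert b (\<phi> ` I))) (insert b (\<phi> ` I) \<inter> {\<phi> t1<..})"
        by (rule openin_open_Int) simp
      then have "openin (top_of_set (insert b (\<phi> ` I)))
          ({u \<in> \<phi> ` I. \<gamma>' u \<in> U} \<union> (insert b (\<phi> ` I) \<inter> {\<phi> t1<..}))"
        using open1 by (rule openin_Un[rotated])
      moreover have "\<gamma> t \<in> U" if "t \<in> I" "\<phi> t1 < \<phi> t" for t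
      proof -
        have "t1 < t" using strict_mono_on_less[OF \<phi>(1) t1(1) that(1)] that(2) by simp
        then show ?thesis using t1 that by simp
      qed
      then have "{u \<in> \<phi> ` I. \<gamma>' u \<in> U} \<union> (insert b (\<phi> ` I) \<inter> {\<phi> t1<..})
          = {u \<in> topspace (top_of_set (insert b (\<phi> ` I))). \<gamma>' u \<in> U}"
        using True \<gamma>'_b \<gamma>'_\<phi> less_b[OF t1(1)] by auto
      ultimately show ?thesis by simp
    next
      case False
      then have "{u \<in> topspace (top_of_set (insert b (\<phi> ` I))). \<gamma>' u \<in> U} = {u \<in> \<phi> ` I. \<gamma>' u \<in> U}"
        using \<gamma>'_b by auto
      then show ?thesis using open1 by simp
    qed
  qed
  then have "continuous_curve T (insert b (\<phi> ` I)) \<gamma>'" using J2 by (simp add: continuous_curve_def)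
  then have "K (insert b (\<phi> ` I)) \<gamma>'" using hom \<gamma>'_b \<gamma>'_\<phi> less_b by (intro K)
  moreover have "causal_rel l (\<gamma>' u) (\<gamma>' v)"
    if uv: "u \<in> insert b (\<phi> ` I)" "v \<in> insert b (\<phi> ` I)" "u < v" for u v
  proof -
    obtain t where t: "t \<in> I" "u = \<phi> t" using uv less_b by force
    show ?thesis
    proof (cases "v = b")
      case True
      then show ?thesis using t p(2) \<gamma>'_b \<gamma>'_\<phi> by simp
    next
      case False
      then obtain s where s: "s \<in> I" "v = \<phi> s" using uv by blast
      then have "t < s" using strict_mono_on_less[OF \<phi>(1) t(1) s(1)] t uv(3) by simp
      then show ?thesis using t s causal \<gamma>'_\<phi> by simp
    qed
  qed
  ultimately have "causal_curve K l (insert b (\<phi> ` I)) \<gamma>'" by (simp add: causal_curve_def)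
  then show ?thesis
    unfolding future_extendible_def
    using J1 J2 hom \<phi>(1) less_b \<gamma>'_\<phi> \<psi>
    by (intro exI[of _ "\<phi> ` I"] exI[of _ \<phi>] exI[of _ \<psi>] exI[of _ "insert b (\<phi> ` I)"] exI[of _ \<gamma>']) auto
qed

text \<open>For merely continuous curves any bounded increasing continuous reparametrization serves,
  and \<open>arctan\<close> is one. The obligation on the class is exactly the continuity already
  established for the extended curve.\<close>

lemma future_extendible_continuous_curve:
  assumes curve: "continuous_curve T I \<gamma>"
    and causal: "\<And>t s. \<lbrakk>t \<in> I; s \<in> I; t < s\<rbrakk> \<Longrightarrow> causal_rel l (\<gamma> t) (\<gamma> s)"
    and sup: "Sup (ereal ` I) \<notin> ereal ` I"
    and p: "p \<in> topspace T" "\<And>t. t \<in> I \<Longrightarrow> causal_rel l (\<gamma> t) p"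
      "\<And>U. \<lbrakk>openin T U; p \<in> U\<rbrakk> \<Longrightarrow> \<exists>t1\<in>I. \<forall>t\<in>I. t1 \<le> t \<longrightarrow> \<gamma> t \<in> U"
  shows "future_extendible (continuous_curve T) l I \<gamma>"
proof (rule future_extendible_if_endpoint[OF curve causal sup p, where \<phi> = arctan])
  show "strict_mono_on I arctan" by (simp add: strict_mono_on_def arctan_less_iff)
  show "bdd_above (arctan ` I)" by (meson arctan_ubound bdd_above.I2 less_imp_le)
qed (auto intro: continuous_intros)

section \<open>Time reversal\<close>

text \<open>The first conjunct of \<open>condition_B\<close>, isolated so that the second can be
  derived from it for the reversed separation function.\<close>

definition future_condition_B ::
    "(real set \<Rightarrow> (real \<Rightarrow> 'a) \<Rightarrow> bool) \<Rightarrow> ('a \<Rightarrow> 'a \<Rightarrow> ereal) \<Rightarrow> bool" where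
  "future_condition_B K l \<longleftrightarrow>
     (\<forall>I \<gamma>. timelike_curve K l I \<gamma> \<and> \<not> future_extendible K l I \<gamma> \<and>
        (\<exists>t0\<in>I. \<exists>C::real. \<forall>s\<in>{t0..} \<inter> I. lor_dist l (\<gamma> t0) (\<gamma> s) \<le> ereal C)
        \<longrightarrow> Sup (ereal ` I) \<in> ereal ` I)"

text \<open>Conjugating \<open>\<phi>\<close> by negation keeps it an increasing homeomorphism and
  turns a later parameter into an earlier one. Reflecting the extended curve reverses its causal
  order, which the swapped arguments of \<open>l\<close> undo.\<close>

lemma past_extendible_if_reverse_future_extendible:
  fixes I :: "real set"
  assumes K: "\<And>J c. K J c \<Longrightarrow> K (uminus ` J) (\<lambda>t. c (- t))"
    and ext: "future_extendible K (\<lambda>x y. l y x) (uminus ` I) (\<lambda>t. \<gamma> (- t))"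
  shows "past_extendible K l I \<gamma>"
proof -
  obtain I1 \<phi> \<psi> I2 \<gamma>' where e: "is_interval I1" "homeomorphism (uminus ` I) I1 \<phi> \<psi>"
      "strict_mono_on (uminus ` I) \<phi>" "is_interval I2" "I1 \<subseteq> I2" "\<exists>t\<in>I2. \<forall>s\<in>I1. s < t"
      "causal_curve K (\<lambda>x y. l y x) I2 \<gamma>'" "\<forall>s\<in>I1. \<gamma>' s = \<gamma> (- \<psi> s)"
    using ext unfolding future_extendible_def by blast
  have refl: "homeomorphism A (uminus ` A) uminus uminus" for A :: "real set"
    by (auto simp: homeomorphism_def image_image intro: continuous_intros)
  have "homeomorphism I (uminus ` I1) (uminus \<circ> (\<phi> \<circ> uminus)) ((uminus \<circ> \<psi>) \<circ> uminus)"
    using refl[of I] e(2) refl[of I1] by (blast intro: homeomorphism_compose)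
  moreover have "strict_mono_on I (uminus \<circ> (\<phi> \<circ> uminus))"
    using e(3) by (auto simp: strict_mono_on_def)
  moreover have "causal_curve K l (uminus ` I2) (\<lambda>t. \<gamma>' (- t))"
    using e(7) K[of I2 \<gamma>'] by (auto simp: causal_curve_def causal_rel_def)
  moreover have "\<exists>t\<in>uminus ` I2. \<forall>s\<in>uminus ` I1. t < s" using e(6) by auto
  moreover have "\<forall>s\<in>uminus ` I1. \<gamma>' (- s) = \<gamma> (((uminus \<circ> \<psi>) \<circ> uminus) s)" using e(8) by auto
  ultimately show ?thesis
    using e(1,4,5) unfolding past_extendible_def
    by (intro exI[of _ "uminus ` I1"] exI[of _ "uminus \<circ> (\<phi> \<circ> uminus)"]
        exI[of _ "(uminus \<circ> \<psi>) \<circ> uminus"] exI[of _ "uminus ` I2"] exI[of _ "\<lambda>t. \<gamma>' (- t)"]) auto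
qed

text \<open>The past half for \<open>l\<close> is the future half for the reversed \<open>l\<close>,
  applied to \<open>t \<mapsto> \<gamma> (- t)\<close>. Closure of \<open>K\<close> under reflection
  keeps this curve and its extensions admissible.\<close>

lemma condition_B_if_future_condition_B:
  fixes l :: "'a \<Rightarrow> 'a \<Rightarrow> ereal"
  assumes K: "\<And>J c. K J c \<Longrightarrow> K (uminus ` J) (\<lambda>t. c (- t))"
    and future: "future_condition_B K l"
    and past: "future_condition_B K (\<lambda>x y. l y x)"
  shows "condition_B K l"
  unfolding condition_B_def
proof (intro conjI allI impI)
  fix I \<gamma>
  assume "timelike_curve K l I \<gamma> \<and> \<not> future_extendible K l I \<gamma> \<and>
    (\<exists>t0\<in>I. \<exists>C::real. \<forall>s\<in>{t0..} \<inter> I. lor_dist l (\<gamma> t0) (\<gamma> s) \<le> ereal C)"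
  then show "Sup (ereal ` I) \<in> ereal ` I" using future unfolding future_condition_B_def by blast
next
  fix I \<gamma>
  assume asm: "timelike_curve K l I \<gamma> \<and> \<not> past_extendible K l I \<gamma> \<and>
    (\<exists>t0\<in>I. \<exists>C::real. \<forall>s\<in>{..t0} \<inter> I. lor_dist l (\<gamma> s) (\<gamma> t0) \<le> ereal C)"
  then obtain t0 C where t0: "t0 \<in> I" "\<And>s. \<lbrakk>s \<in> I; s \<le> t0\<rbrakk> \<Longrightarrow> lor_dist l (\<gamma> s) (\<gamma> t0) \<le> ereal C"
    by auto
  have "timelike_curve K (\<lambda>x y. l y x) (uminus ` I) (\<lambda>t. \<gamma> (- t))"
    using asm K[of I \<gamma>] by (auto simp: timelike_curve_def chron_rel_def lor_dist_def)
  moreover have "\<not> future_extendible K (\<lambda>x y. l y x) (uminus ` I) (\<lambda>t. \<gamma> (- t))"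
    using asm past_extendible_if_reverse_future_extendible[of K l I \<gamma>] K by blast
  moreover have "\<exists>t0\<in>uminus ` I. \<exists>C::real. \<forall>s\<in>{t0..} \<inter> uminus ` I.
      lor_dist (\<lambda>x y. l y x) (\<gamma> (- t0)) (\<gamma> (- s)) \<le> ereal C"
    using t0 by (intro bexI[of _ "- t0"] exI[of _ C]) (auto simp: lor_dist_def)
  ultimately have "Sup (ereal ` uminus ` I) \<in> ereal ` uminus ` I"
    using past unfolding future_condition_B_def by blast
  moreover have "ereal ` uminus ` I = uminus ` ereal ` I" by (simp add: image_image)
  ultimately have "- Inf (ereal ` I) \<in> uminus ` ereal ` I"
    by (simp add: ereal_Sup_uminus_image_eq)
  then show "Inf (ereal ` I) \<in> ereal ` I" by (auto simp: ereal_uminus_eq_reorder)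
qed

lemma continuous_curve_reflect:
  assumes "continuous_curve T J c"
  shows "continuous_curve T (uminus ` J) (\<lambda>t. c (- t))"
proof -
  have "continuous_map (top_of_set (uminus ` J)) (top_of_set J) uminus"
    by (auto intro: continuous_intros)
  moreover have "continuous_map (top_of_set J) T c"
    using assms by (simp add: continuous_curve_def)
  ultimately have "continuous_map (top_of_set (uminus ` J)) T (c \<circ> uminus)"
    by (rule continuous_map_compose)
  then show ?thesis using assms by (simp add: continuous_curve_def o_def)
qed

lemma causally_simple_reverse: "causally_simple T l \<Longrightarrow> causally_simple T (\<lambda>x y. l y x)"
  by (auto simp: causally_simple_def antisymp_on_def causal_future_def causal_past_def causal_rel_def)

lemma timelike_Cauchy_complete_reverse:
  "timelike_Cauchy_complete T l \<Longrightarrow> timelike_Cauchy_complete T (\<lambda>x y. l y x)"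
  unfolding timelike_Cauchy_complete_def chron_rel_def lor_dist_def by blast

lemma tsep_plus_commute: "tsep_plus a b = tsep_plus b a"
  by (simp add: tsep_plus_def add.commute)

lemma time_separation_reverse: "time_separation X l \<Longrightarrow> time_separation X (\<lambda>x y. l y x)"
  unfolding time_separation_def by (metis tsep_plus_commute)

section \<open>Arclength\<close>

text \<open>The real number inside the supremum of \<open>arclength\<close>. Truncated subtraction
  makes it 0 for lists with at most one entry.\<close>

definition polygon_length :: "'a metric \<Rightarrow> (real \<Rightarrow> 'a) \<Rightarrow> real list \<Rightarrow> real" where
  "polygon_length \<rho> \<gamma> ts = (\<Sum>i<length ts - 1. mdist \<rho> (\<gamma> (ts ! i)) (\<gamma> (ts ! Suc i)))"

lemma polygon_length_Nil [simp]: "polygon_length \<rho> \<gamma> [] = 0"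
  by (simp add: polygon_length_def)

lemma polygon_length_snoc:
  assumes "ts \<noteq> []"
  shows "polygon_length \<rho> \<gamma> (ts @ [t]) = polygon_length \<rho> \<gamma> ts + mdist \<rho> (\<gamma> (last ts)) (\<gamma> t)"
proof -
  obtain n where n: "length ts = Suc n" using assms by (cases ts) auto
  then have "last ts = ts ! n" using assms by (simp add: last_conv_nth)
  with n show ?thesis by (simp add: polygon_length_def nth_append)
qed

text \<open>For nonempty \<open>ts\<close> the right side has one more segment, from the last node
  to \<open>t\<close>, whose length is nonnegative; hence only an inequality.\<close>

lemma polygon_length_append_two:
  "polygon_length \<rho> \<gamma> ts + mdist \<rho> (\<gamma> t) (\<gamma> s) \<le> polygon_length \<rho> \<gamma> (ts @ [t, s])"
proof (cases "ts = []")
  case True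
  then show ?thesis by (simp add: polygon_length_def)
next
  case False
  then show ?thesis
    using polygon_length_snoc[of ts \<rho> \<gamma> t] polygon_length_snoc[of "ts @ [t]" \<rho> \<gamma> s] by simp
qed

lemma polygon_length_rev:
  "polygon_length \<rho> (\<lambda>t. \<gamma> (- t)) (rev (map uminus ts)) = polygon_length \<rho> \<gamma> ts"
proof -
  let ?g = "\<lambda>i. mdist \<rho> (\<gamma> (ts ! i)) (\<gamma> (ts ! Suc i))"
  have "polygon_length \<rho> (\<lambda>t. \<gamma> (- t)) (rev (map uminus ts))
      = (\<Sum>i<length ts - 1. ?g (length ts - 1 - Suc i))"
    unfolding polygon_length_def
  proof (intro sum.cong)
    fix i assume i: "i \<in> {..<length ts - 1}"
    \<comment> \<open>Segment \<open>i\<close> of the reversed list is segment \<open>j\<close> of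
      \<open>ts\<close> traversed backwards, so symmetry of the metric matches the two
      terms.\<close>
    define j where "j = length ts - 1 - Suc i"
    have "length ts - Suc i = Suc j" "length ts - Suc (Suc i) = j" using i by (auto simp: j_def)
    then have "rev (map uminus ts) ! i = - (ts ! Suc j)" "rev (map uminus ts) ! Suc i = - (ts ! j)"
      using i by (simp_all add: rev_nth)
    then show "mdist \<rho> (\<gamma> (- rev (map uminus ts) ! i)) (\<gamma> (- rev (map uminus ts) ! Suc i))
        = ?g (length ts - 1 - Suc i)"
      unfolding j_def[symmetric] by (simp only: minus_minus mdist_commute)
  qed simp
  also have "\<dots> = (\<Sum>i<length ts - 1. ?g i)"
    by (rule sum.nat_diff_reindex)
  finally show ?thesis by (simp add: polygon_length_def)
qed

lemma polygon_length_le_arclength: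
  assumes "sorted ts" "set ts \<subseteq> I"
  shows "ereal (polygon_length \<rho> \<gamma> ts) \<le> arclength \<rho> I \<gamma>"
  unfolding arclength_def polygon_length_def using assms by (intro SUP_upper) simp

text \<open>Negating and reversing a sorted list of parameters gives a sorted list for the reflected
  curve with the same polygon length.\<close>

lemma arclength_reflect_le: "arclength \<rho> I \<gamma> \<le> arclength \<rho> (uminus ` I) (\<lambda>t. \<gamma> (- t))"
  unfolding arclength_def[of \<rho> I \<gamma>] polygon_length_def[symmetric]
proof (rule SUP_least)
  fix ts assume "ts \<in> {ts. sorted ts \<and> set ts \<subseteq> I}"
  then have ts: "sorted ts" "set ts \<subseteq> I" by auto
  have "sorted (rev (map uminus ts))"
    using ts(1) by (simp add: sorted_wrt_rev sorted_wrt_map)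
  moreover have "set (rev (map uminus ts)) \<subseteq> uminus ` I" using ts(2) by auto
  ultimately have "ereal (polygon_length \<rho> (\<lambda>t. \<gamma> (- t)) (rev (map uminus ts)))
      \<le> arclength \<rho> (uminus ` I) (\<lambda>t. \<gamma> (- t))"
    by (rule polygon_length_le_arclength)
  then show "ereal (polygon_length \<rho> \<gamma> ts) \<le> arclength \<rho> (uminus ` I) (\<lambda>t. \<gamma> (- t))"
    by (simp only: polygon_length_rev)
qed

section \<open>Time reversal of locally Lipschitz curves and of metric compatibility\<close>

lemma Lipschitz_continuous_map_real_iff:
  "Lipschitz_continuous_map (submetric euclidean_metric S) \<rho> c \<longleftrightarrow>
    c ` S \<subseteq> mspace \<rho> \<and> (\<exists>B>0. \<forall>x\<in>S. \<forall>y\<in>S. mdist \<rho> (c x) (c y) \<le> B * \<bar>x - y\<bar>)"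
  for S :: "real set"
  unfolding Lipschitz_continuous_map_pos mspace_submetric mdist_submetric mspace_euclidean_metric
    mdist_euclidean_metric dist_real_def image_subset_iff_funcset by simp

lemma lipschitz_curve_reflect:
  assumes "lipschitz_curve \<rho> J c"
  shows "lipschitz_curve \<rho> (uminus ` J) (\<lambda>t. c (- t))"
  unfolding lipschitz_curve_def
proof (intro conjI ballI)
  show "continuous_curve (mtopology_of \<rho>) (uminus ` J) (\<lambda>t. c (- t))"
    using assms by (simp add: lipschitz_curve_def continuous_curve_reflect)
  fix t assume "t \<in> uminus ` J"
  then have "- t \<in> J" by auto
  then obtain e where e: "e > 0"
    "Lipschitz_continuous_map (submetric euclidean_metric (J \<inter> ball (- t) e)) \<rho> c"
    using assms by (auto simp: lipschitz_curve_def)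
  then obtain B where B: "B > 0" "c ` (J \<inter> ball (- t) e) \<subseteq> mspace \<rho>"
    "\<And>x y. \<lbrakk>x \<in> J \<inter> ball (- t) e; y \<in> J \<inter> ball (- t) e\<rbrakk> \<Longrightarrow> mdist \<rho> (c x) (c y) \<le> B * \<bar>x - y\<bar>"
    by (auto simp only: Lipschitz_continuous_map_real_iff)
  have mem: "- x \<in> J \<inter> ball (- t) e" if "x \<in> uminus ` J \<inter> ball t e" for x
    using that by (auto simp: dist_real_def)
  have "mdist \<rho> (c (- x)) (c (- y)) \<le> B * \<bar>x - y\<bar>"
    if "x \<in> uminus ` J \<inter> ball t e" "y \<in> uminus ` J \<inter> ball t e" for x y
    using B(3)[OF mem[OF that(1)] mem[OF that(2)]] by (simp add: abs_minus_commute)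
  moreover have "(\<lambda>t. c (- t)) ` (uminus ` J \<inter> ball t e) \<subseteq> mspace \<rho>"
    using B(2) mem by blast
  ultimately have "Lipschitz_continuous_map
      (submetric euclidean_metric (uminus ` J \<inter> ball t e)) \<rho> (\<lambda>t. c (- t))"
    unfolding Lipschitz_continuous_map_real_iff using B(1) by blast
  with e(1) show "\<exists>e>0. Lipschitz_continuous_map
      (submetric euclidean_metric (uminus ` J \<inter> ball t e)) \<rho> (\<lambda>t. c (- t))" by blast
qed

lemma metric_compatibleE:
  assumes "metric_compatible \<rho> l" "x \<in> mspace \<rho>"
  obtains U V C where "openin (mtopology_of \<rho>) V" "x \<in> V" "V \<subseteq> U" "U \<subseteq> mspace \<rho>" "0 < C"
    "\<forall>I \<gamma>. causal_curve (lipschitz_curve \<rho>) l I \<gamma> \<and> \<gamma> ` I \<subseteq> U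
      \<longrightarrow> arclength \<rho> I \<gamma> \<le> ereal C"
  using bspec[OF assms(1)[unfolded metric_compatible_def] assms(2)] by (elim exE conjE) (rule that)

text \<open>The same neighbourhood and constant work: reflecting a causal curve of the reversed
  \<open>l\<close> gives a causal curve of \<open>l\<close> with the same image and no smaller
  arclength.\<close>

lemma metric_compatible_reverse:
  assumes "metric_compatible \<rho> l"
  shows "metric_compatible \<rho> (\<lambda>x y. l y x)"
  unfolding metric_compatible_def
proof
  fix x assume "x \<in> mspace \<rho>"
  then obtain U V C where *: "openin (mtopology_of \<rho>) V" "x \<in> V" "V \<subseteq> U" "U \<subseteq> mspace \<rho>" "0 < C"
    and bound: "\<forall>I \<gamma>. causal_curve (lipschitz_curve \<rho>) l I \<gamma> \<and> \<gamma> ` I \<subseteq> U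
      \<longrightarrow> arclength \<rho> I \<gamma> \<le> ereal C"
    by (rule metric_compatibleE[OF assms])
  have "arclength \<rho> I \<gamma> \<le> ereal C"
    if "causal_curve (lipschitz_curve \<rho>) (\<lambda>x y. l y x) I \<gamma>" "\<gamma> ` I \<subseteq> U" for I \<gamma>
  proof -
    have "causal_curve (lipschitz_curve \<rho>) l (uminus ` I) (\<lambda>t. \<gamma> (- t))"
      using that(1) lipschitz_curve_reflect[of \<rho> I \<gamma>] by (auto simp: causal_curve_def causal_rel_def)
    moreover have "(\<lambda>t. \<gamma> (- t)) ` uminus ` I \<subseteq> U" using that(2) by auto
    ultimately show ?thesis by (rule order_trans[OF arclength_reflect_le bound[rule_format, OF conjI]])
  qed
  with * show "\<exists>U V C. openin (mtopology_of \<rho>) V \<and> x \<in> V \<and> V \<subseteq> U \<and> U \<subseteq> mspace \<rho> \<and> 0 < C \<and>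
      (\<forall>I \<gamma>. causal_curve (lipschitz_curve \<rho>) (\<lambda>x y. l y x) I \<gamma> \<and> \<gamma> ` I \<subseteq> U \<longrightarrow>
        arclength \<rho> I \<gamma> \<le> ereal C)"
    by (intro exI[of _ U] exI[of _ V] exI[of _ C]) simp
qed

text \<open>If the increments of \<open>F\<close> dominate the distances along the curve, each
  polygon is bounded term by term by a telescoping sum.\<close>

lemma polygon_length_le_telescope:
  assumes F: "\<And>u v. \<lbrakk>u \<in> A; v \<in> A; u \<le> v\<rbrakk> \<Longrightarrow> mdist \<rho> (\<gamma> u) (\<gamma> v) \<le> F v - F u"
    and ts: "sorted ts" "set ts \<subseteq> A" "ts \<noteq> []"
  shows "polygon_length \<rho> \<gamma> ts \<le> F (last ts) - F (hd ts)"
proof -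
  have "polygon_length \<rho> \<gamma> ts \<le> (\<Sum>i<length ts - 1. F (ts ! Suc i) - F (ts ! i))"
    unfolding polygon_length_def
  proof (rule sum_mono)
    fix i assume "i \<in> {..<length ts - 1}"
    then have i: "i < length ts" "Suc i < length ts" by auto
    then have "ts ! i \<in> A" "ts ! Suc i \<in> A" using ts(2) by (auto simp: subset_iff)
    moreover have "ts ! i \<le> ts ! Suc i" using ts(1) i by (simp add: sorted_nth_mono)
    ultimately show "mdist \<rho> (\<gamma> (ts ! i)) (\<gamma> (ts ! Suc i)) \<le> F (ts ! Suc i) - F (ts ! i)"
      by (rule F)
  qed
  also have "\<dots> = F (last ts) - F (hd ts)"
    using sum_lessThan_telescope[of "\<lambda>i. F (ts ! i)"] ts(3) by (simp add: last_conv_nth hd_conv_nth)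
  finally show ?thesis .
qed

section \<open>The variation function of a rectifiable curve\<close>

definition variation :: "'a metric \<Rightarrow> (real \<Rightarrow> 'a) \<Rightarrow> real set \<Rightarrow> real" where
  "variation \<rho> \<gamma> A = (SUP ts \<in> {ts. sorted ts \<and> set ts \<subseteq> A}. polygon_length \<rho> \<gamma> ts)"

text \<open>The uniform bound \<open>C\<close> makes the real supremum in \<open>variation\<close> a
  genuine one. In the application \<open>A\<close> is a final segment of the parameter interval and
  \<open>C\<close> comes from metric compatibility.\<close>

locale rectifiable =
  fixes \<rho> :: "'a metric" and \<gamma> :: "real \<Rightarrow> 'a" and A :: "real set" and C :: real
  assumes polygon_length_le: "\<lbrakk>sorted ts; set ts \<subseteq> A\<rbrakk> \<Longrightarrow> polygon_length \<rho> \<gamma> ts \<le> C"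
    and mspace: "t \<in> A \<Longrightarrow> \<gamma> t \<in> mspace \<rho>"
begin

text \<open>The arclength travelled in \<open>A\<close> up to \<open>t\<close>. It is defined for
  all real \<open>t\<close>; before \<open>A\<close> begins, only the empty list competes and the
  value is 0.\<close>

definition V :: "real \<Rightarrow> real" where
  "V t = variation \<rho> \<gamma> (A \<inter> {..t})"

lemma polygon_length_le_V: "\<lbrakk>sorted ts; set ts \<subseteq> A \<inter> {..t}\<rbrakk> \<Longrightarrow> polygon_length \<rho> \<gamma> ts \<le> V t"
  unfolding V_def variation_def
  by (rule cSUP_upper) (auto intro!: bdd_aboveI2[of _ _ C] polygon_length_le)

lemma V_least:
  assumes "\<And>ts. \<lbrakk>sorted ts; set ts \<subseteq> A \<inter> {..t}\<rbrakk> \<Longrightarrow> polygon_length \<rho> \<gamma> ts \<le> M"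
  shows "V t \<le> M"
  unfolding V_def variation_def
proof (rule cSUP_least)
  have "[] \<in> {ts. sorted ts \<and> set ts \<subseteq> A \<inter> {..t}}" by simp
  then show "{ts. sorted ts \<and> set ts \<subseteq> A \<inter> {..t}} \<noteq> {}" by blast
qed (use assms in auto)

lemma V_nonneg: "0 \<le> V t"
  using polygon_length_le_V[of "[]"] by simp

lemma V_le: "V t \<le> C"
  by (rule V_least) (auto intro: polygon_length_le)

lemma V_mono: "t \<le> s \<Longrightarrow> V t \<le> V s"
  by (rule V_least) (auto intro!: polygon_length_le_V)

text \<open>Appending \<open>t\<close> and \<open>s\<close> to any partition up to \<open>t\<close>
  gives a partition up to \<open>s\<close> that is longer by at least the distance of the two
  points.\<close>

lemma mdist_le_V:
  assumes "t \<in> A" "s \<in> A" "t \<le> s"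
  shows "mdist \<rho> (\<gamma> t) (\<gamma> s) \<le> V s - V t"
proof -
  have "V t \<le> V s - mdist \<rho> (\<gamma> t) (\<gamma> s)"
  proof (rule V_least)
    fix ts assume ts: "sorted ts" "set ts \<subseteq> A \<inter> {..t}"
    have "polygon_length \<rho> \<gamma> (ts @ [t, s]) \<le> V s"
      by (rule polygon_length_le_V) (use ts assms in \<open>auto simp: sorted_append\<close>)
    then show "polygon_length \<rho> \<gamma> ts \<le> V s - mdist \<rho> (\<gamma> t) (\<gamma> s)"
      using polygon_length_append_two[of \<rho> \<gamma> ts t s] by simp
  qed
  then show ?thesis by simp
qed

text \<open>A Lipschitz bound on the curve passes to its arclength. The hypothesis named
  \<open>t\<close> lets a segment that crosses \<open>t\<close> be split at
  \<open>\<gamma> t\<close>.\<close>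

lemma V_le_if_Lipschitz:
  assumes "t \<le> s" "0 \<le> B" and t: "\<And>u. \<lbrakk>u \<in> A; u \<le> t\<rbrakk> \<Longrightarrow> t \<in> A"
    and B: "\<And>u v. \<lbrakk>u \<in> A; v \<in> A; t \<le> u; u \<le> v; v \<le> s\<rbrakk> \<Longrightarrow> mdist \<rho> (\<gamma> u) (\<gamma> v) \<le> B * (v - u)"
  shows "V s \<le> V t + B * (s - t)"
proof (rule V_least)
  fix ts assume ts: "sorted ts" "set ts \<subseteq> A \<inter> {..s}"
  \<comment> \<open>Arclength is the least function dominating \<open>mdist\<close>, and \<open>F\<close>, which follows \<open>V\<close> up to \<open>t\<close> and has
    slope \<open>B\<close> from there on, dominates it too.\<close>
  define F where "F u = V (min u t) + B * max 0 (u - t)" for u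
  show "polygon_length \<rho> \<gamma> ts \<le> V t + B * (s - t)"
  proof (cases "ts = []")
    case True
    then show ?thesis using V_nonneg assms(1,2) by simp
  next
    case False
    have "polygon_length \<rho> \<gamma> ts \<le> F (last ts) - F (hd ts)"
    proof (rule polygon_length_le_telescope[OF _ ts False])
      fix u v assume uv: "u \<in> A \<inter> {..s}" "v \<in> A \<inter> {..s}" "u \<le> v"
      consider "v \<le> t" | "u \<le> t" "t < v" | "t < u" using uv by linarith
      then show "mdist \<rho> (\<gamma> u) (\<gamma> v) \<le> F v - F u"
      proof cases
        case 1
        then show ?thesis using mdist_le_V[of u v] uv by (simp add: F_def)
      next
        case 2
        then have "t \<in> A" using t uv by blast
        then have "mdist \<rho> (\<gamma> u) (\<gamma> v) \<le> mdist \<rho> (\<gamma> u) (\<gamma> t) + mdist \<rho> (\<gamma> t) (\<gamma> v)"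
          using uv by (intro mdist_triangle) (auto intro: mspace)
        also have "\<dots> \<le> (V t - V u) + B * (v - t)"
          using mdist_le_V[of u t] B[of t v] 2 uv \<open>t \<in> A\<close> by (intro add_mono) auto
        finally show ?thesis using 2 by (simp add: F_def)
      next
        case 3
        then show ?thesis using B[of u v] uv by (simp add: F_def algebra_simps)
      qed
    qed
    moreover have "0 \<le> F (hd ts)" using assms(2) V_nonneg by (simp add: F_def)
    moreover have "F (last ts) \<le> V t + B * (s - t)"
    proof -
      have "last ts \<le> s" using ts(2) False last_in_set by blast
      then show ?thesis unfolding F_def using assms(1,2)
        by (intro add_mono V_mono mult_left_mono) auto
    qed
    ultimately show ?thesis by linarith
  qed
qed

end

section \<open>Reparametrization by arclength\<close>

text \<open>By the mean value theorem, since the derivative of \<open>arctan\<close> at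
  \<open>z\<close> is \<open>1 / (1 + z^2)\<close> and
  \<open>\<bar>z\<bar> \<le> \<bar>t\<bar> + 1\<close> between \<open>x\<close> and
  \<open>y\<close>. It says that the inverse of \<open>arctan\<close> is locally Lipschitz.\<close>

lemma abs_diff_le_arctan:
  fixes x y t :: real
  assumes "\<bar>x - t\<bar> \<le> 1" "\<bar>y - t\<bar> \<le> 1"
  shows "\<bar>x - y\<bar> \<le> (1 + (\<bar>t\<bar> + 1)\<^sup>2) * \<bar>arctan x - arctan y\<bar>"
  using assms
proof (induction x y rule: linorder_wlog)
  case (le x y)
  show ?case
  proof (cases "x = y")
    case False
    then have "x < y" using le by simp
    then obtain z where z: "x < z" "z < y" "arctan y - arctan x = (y - x) * inverse (1 + z\<^sup>2)"
      using MVT2[of x y arctan "\<lambda>z. inverse (1 + z\<^sup>2)"] DERIV_arctan by blast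
    have "\<bar>z\<bar> \<le> \<bar>t\<bar> + 1" using le z by linarith
    then have "z\<^sup>2 \<le> (\<bar>t\<bar> + 1)\<^sup>2" by (simp add: abs_le_square_iff[symmetric])
    then have "(1 + z\<^sup>2) * (arctan y - arctan x) \<le> (1 + (\<bar>t\<bar> + 1)\<^sup>2) * (arctan y - arctan x)"
      using \<open>x < y\<close> by (intro mult_right_mono) (auto simp: arctan_le_iff)
    moreover have "(1 + z\<^sup>2) * (arctan y - arctan x) = y - x"
    proof -
      have "1 + z\<^sup>2 \<noteq> 0" by (metis power_one sum_power2_eq_zero_iff zero_neq_one)
      then show ?thesis using z(3) by (simp add: field_simps)
    qed
    moreover have "arctan x < arctan y" using \<open>x < y\<close> by (simp add: arctan_less_iff)
    ultimately show ?thesis using \<open>x < y\<close> by simp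
  qed simp
next
  case (sym x y)
  then show ?case by (simp add: abs_minus_commute)
qed

context rectifiable
begin

text \<open>Near each \<open>t\<close> the curve is Lipschitz with some constant \<open>B\<close>,
  so the increments of \<open>V\<close> are at most \<open>B\<close> times those of the
  parameter.\<close>

lemma continuous_on_V:
  assumes "A = I \<inter> {t1..}" and \<gamma>: "lipschitz_curve \<rho> I \<gamma>"
  shows "continuous_on I V"
  unfolding continuous_on_iff
proof (intro ballI allI impI)
  fix t and \<epsilon> :: real assume t: "t \<in> I" and \<epsilon>: "\<epsilon> > 0"
  obtain e where e: "e > 0"
    "Lipschitz_continuous_map (submetric euclidean_metric (I \<inter> ball t e)) \<rho> \<gamma>"
    using \<gamma> t by (auto simp: lipschitz_curve_def)
  then obtain B where B: "B > 0"
    "\<And>x y. \<lbrakk>x \<in> I \<inter> ball t e; y \<in> I \<inter> ball t e\<rbrakk> \<Longrightarrow> mdist \<rho> (\<gamma> x) (\<gamma> y) \<le> B * \<bar>x - y\<bar>"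
    by (auto simp only: Lipschitz_continuous_map_real_iff)
  have bound: "V y \<le> V x + B * (y - x)" if xy: "x \<in> I" "x \<le> y" "\<bar>x - t\<bar> < e" "\<bar>y - t\<bar> < e" for x y
  proof (rule V_le_if_Lipschitz)
    \<comment> \<open>\<open>A\<close> is closed upwards within \<open>I\<close>.\<close>
    show "x \<in> A" if "u \<in> A" "u \<le> x" for u using that xy assms(1) by auto
    show "mdist \<rho> (\<gamma> u) (\<gamma> v) \<le> B * (v - u)"
      if "u \<in> A" "v \<in> A" "x \<le> u" "u \<le> v" "v \<le> y" for u v
    proof -
      have "\<bar>u - t\<bar> < e" "\<bar>v - t\<bar> < e" using that xy by linarith+
      then have "u \<in> I \<inter> ball t e" "v \<in> I \<inter> ball t e"
        using that assms(1) by (auto simp: dist_real_def abs_minus_commute)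
      from B(2)[OF this] that(4) show ?thesis by simp
    qed
  qed (use xy B in auto)
  show "\<exists>d>0. \<forall>s\<in>I. dist s t < d \<longrightarrow> dist (V s) (V t) < \<epsilon>"
  proof (intro exI[of _ "min e (\<epsilon> / B)"] conjI ballI impI)
    show "0 < min e (\<epsilon> / B)" using e(1) B(1) \<epsilon> by simp
    fix s assume s: "s \<in> I" "dist s t < min e (\<epsilon> / B)"
    then have "B * \<bar>s - t\<bar> < \<epsilon>" using B(1) by (simp add: dist_real_def field_simps)
    moreover have "\<bar>V s - V t\<bar> \<le> B * \<bar>s - t\<bar>"
    proof (cases "s \<le> t")
      case True
      then show ?thesis using bound[of s t] V_mono[of s t] s e(1) by (simp add: dist_real_def algebra_simps)
    next
      case False
      then show ?thesis using bound[of t s] V_mono[of t s] s t e(1) by (simp add: dist_real_def algebra_simps)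
    qed
    ultimately show "dist (V s) (V t) < \<epsilon>" by (simp add: dist_real_def)
  qed
qed

text \<open>The function \<open>\<phi>\<close> is bounded by \<open>pi / 2 + C\<close>, and its
  increments dominate those of both summands. Near \<open>b\<close> the summand \<open>V\<close>
  controls distances directly; at any other point \<open>\<gamma>\<close> is locally Lipschitz and
  the summand \<open>arctan\<close> controls the old parameter by the new one.\<close>

lemma future_extendible_lipschitz_curve:
  assumes A: "A = I \<inter> {t1..}" "t1 \<in> I" and curve: "lipschitz_curve \<rho> I \<gamma>"
    and causal: "\<And>t s. \<lbrakk>t \<in> I; s \<in> I; t < s\<rbrakk> \<Longrightarrow> causal_rel l (\<gamma> t) (\<gamma> s)"
    and sup: "Sup (ereal ` I) \<notin> ereal ` I"
    and p: "p \<in> mspace \<rho>" "\<And>t. t \<in> I \<Longrightarrow> causal_rel l (\<gamma> t) p"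
      "\<And>U. \<lbrakk>openin (mtopology_of \<rho>) U; p \<in> U\<rbrakk> \<Longrightarrow> \<exists>t1\<in>I. \<forall>t\<in>I. t1 \<le> t \<longrightarrow> \<gamma> t \<in> U"
  shows "future_extendible (lipschitz_curve \<rho>) l I \<gamma>"
proof -
  define \<phi> where "\<phi> t = arctan t + V t" for t
  have arctan_le: "arctan s - arctan t \<le> \<phi> s - \<phi> t" if "t \<le> s" for t s
    using V_mono[OF that] by (simp add: \<phi>_def)
  have \<phi>_less: "\<phi> t < \<phi> s" if "t < s" for t s
    using arctan_le[of t s] that arctan_less_iff[of t s] by linarith
  have mdist_le: "mdist \<rho> (\<gamma> t) (\<gamma> s) \<le> \<phi> s - \<phi> t" if "t \<in> I" "s \<in> I" "t1 \<le> t" "t \<le> s" for t s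
    using mdist_le_V[of t s] that A arctan_le_iff[of t s] by (simp add: \<phi>_def)
  have \<gamma>_top: "\<gamma> t \<in> mspace \<rho>" if "t \<in> I" for t
    using curve that by (auto simp: lipschitz_curve_def continuous_curve_def continuous_map_def Pi_iff)
  define b where "b = Sup (\<phi> ` I)"
  define J where "J = insert b (\<phi> ` I)"
  have bdd: "bdd_above (\<phi> ` I)"
  proof (rule bdd_aboveI2)
    show "\<phi> t \<le> pi / 2 + C" for t
      using arctan_ubound[of t] V_le[of t] by (simp add: \<phi>_def)
  qed
  have le_b: "\<phi> t \<le> b" if "t \<in> I" for t
    using bdd that unfolding b_def by (auto intro: cSup_upper)
  \<comment> \<open>The limiting case of \<open>mdist_le\<close>: pass through a later point
    \<open>\<gamma> s\<close> within \<open>\<epsilon>\<close> of \<open>p\<close>.\<close>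
  have mdist_p: "mdist \<rho> (\<gamma> t) p \<le> b - \<phi> t" if t: "t \<in> I" "t1 \<le> t" for t
  proof (rule field_le_epsilon)
    fix \<epsilon> :: real assume "\<epsilon> > 0"
    interpret M: Metric_space "mspace \<rho>" "mdist \<rho>" by (rule Metric_space_mspace_mdist)
    have "openin (mtopology_of \<rho>) (M.mball p \<epsilon>)" unfolding mtopology_of_def by (rule M.openin_mball)
    moreover have "p \<in> M.mball p \<epsilon>" using p(1) \<open>\<epsilon> > 0\<close> by simp
    ultimately obtain t2 where t2: "t2 \<in> I" "\<forall>t\<in>I. t2 \<le> t \<longrightarrow> \<gamma> t \<in> M.mball p \<epsilon>" using p(3) by blast
    define s where "s = max t t2"
    have s: "s \<in> I" "t \<le> s" "t2 \<le> s" using t t2 by (auto simp: s_def max_def)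
    have "mdist \<rho> (\<gamma> t) p \<le> mdist \<rho> (\<gamma> t) (\<gamma> s) + mdist \<rho> (\<gamma> s) p"
      using \<gamma>_top t(1) s(1) p(1) by (intro mdist_triangle) auto
    moreover have "mdist \<rho> (\<gamma> t) (\<gamma> s) \<le> \<phi> s - \<phi> t" using t s by (intro mdist_le)
    moreover have "\<gamma> s \<in> M.mball p \<epsilon>" using t2(2) s by blast
    then have "mdist \<rho> (\<gamma> s) p < \<epsilon>" by (simp add: M.commute)
    ultimately show "mdist \<rho> (\<gamma> t) p \<le> b - \<phi> t + \<epsilon>" using le_b[OF s(1)] by linarith
  qed
  have "continuous_curve (mtopology_of \<rho>) I \<gamma>" using curve by (simp add: lipschitz_curve_def)
  then show ?thesis
  proof (rule future_extendible_if_endpoint[where \<phi> = \<phi> and p = p and I = I, folded b_def J_def])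
    show "strict_mono_on I \<phi>" using \<phi>_less by (simp add: strict_mono_on_def)
    show "continuous_on I \<phi>"
      unfolding \<phi>_def using continuous_on_V[OF A(1) curve] by (intro continuous_intros)
    fix \<psi> \<gamma>' assume hom: "homeomorphism I (\<phi> ` I) \<phi> \<psi>"
      and cont: "continuous_curve (mtopology_of \<rho>) J \<gamma>'"
      and \<gamma>'_b: "\<gamma>' b = p" and less_b: "\<And>t. t \<in> I \<Longrightarrow> \<phi> t < b" and \<gamma>'_\<phi>: "\<And>t. t \<in> I \<Longrightarrow> \<gamma>' (\<phi> t) = \<gamma> t"
    have \<psi>: "\<psi> (\<phi> t) = t" if "t \<in> I" for t using hom that by (auto simp: homeomorphism_def)
    have \<gamma>'_top: "\<gamma>' ` S \<subseteq> mspace \<rho>" if "S \<subseteq> J" for S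
      using that p(1) \<gamma>_top \<gamma>'_b \<gamma>'_\<phi> by (auto simp: J_def)
    \<comment> \<open>Beyond \<open>\<phi> t1\<close> the extended curve is 1-Lipschitz, by
      \<open>mdist_le\<close> between old points and \<open>mdist_p\<close> when one of them is
      \<open>b\<close>.\<close>
    have near_b: "mdist \<rho> (\<gamma>' x) (\<gamma>' y) \<le> \<bar>x - y\<bar>" if "x \<in> J" "y \<in> J" "\<phi> t1 < x" "\<phi> t1 < y" for x y
      using that
    proof (induction x y rule: linorder_wlog)
      case (le x y)
      show ?case
      proof (cases "x = b")
        case True
        then have "y = b" using le less_b by (force simp: J_def)
        then show ?thesis using True \<gamma>'_b p(1) by (simp add: Metric_space.mdist_zero[OF Metric_space_mspace_mdist])
      next
        case False
        then obtain t where t: "t \<in> I" "x = \<phi> t" using le by (auto simp: J_def)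
        then have t1: "t1 \<le> t" using le \<phi>_less[of t t1] by fastforce
        show ?thesis
        proof (cases "y = b")
          case True
          then show ?thesis using mdist_p[of t] t t1 le \<gamma>'_b \<gamma>'_\<phi> by simp
        next
          case False
          then obtain s where s: "s \<in> I" "y = \<phi> s" using le by (auto simp: J_def)
          then have "t \<le> s" using le t \<phi>_less[of s t] by fastforce
          then show ?thesis using mdist_le[of t s] s t t1 le \<gamma>'_\<phi> by simp
        qed
      qed
    next
      case (sym x y)
      then show ?case by (simp add: abs_minus_commute mdist_commute)
    qed
    show "lipschitz_curve \<rho> J \<gamma>'"
      unfolding lipschitz_curve_def
    proof (intro conjI ballI cont)
      fix u assume u: "u \<in> J"
      show "\<exists>e>0. Lipschitz_continuous_map (submetric euclidean_metric (J \<inter> ball u e)) \<rho> \<gamma>'"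
      proof (cases "u = b")
        case True
        have "\<phi> t1 < x" if "x \<in> ball u (b - \<phi> t1)" for x
          using that True by (auto simp: dist_real_def)
        then have "\<forall>x\<in>J \<inter> ball u (b - \<phi> t1). \<forall>y\<in>J \<inter> ball u (b - \<phi> t1).
            mdist \<rho> (\<gamma>' x) (\<gamma>' y) \<le> 1 * \<bar>x - y\<bar>"
          using near_b by simp
        then show ?thesis
          unfolding Lipschitz_continuous_map_real_iff
          using \<gamma>'_top less_b[OF A(2)] by (intro exI[of _ "b - \<phi> t1"]) (auto intro!: exI[of _ 1])
      next
        case False
        then obtain t where t: "t \<in> I" "u = \<phi> t" using u by (auto simp: J_def)
        obtain e where e: "e > 0"
          "Lipschitz_continuous_map (submetric euclidean_metric (I \<inter> ball t e)) \<rho> \<gamma>"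
          using curve t(1) by (auto simp: lipschitz_curve_def)
        then obtain B where B: "B > 0"
          "\<And>x y. \<lbrakk>x \<in> I \<inter> ball t e; y \<in> I \<inter> ball t e\<rbrakk> \<Longrightarrow> mdist \<rho> (\<gamma> x) (\<gamma> y) \<le> B * \<bar>x - y\<bar>"
          by (auto simp only: Lipschitz_continuous_map_real_iff)
        have "continuous_on (\<phi> ` I) \<psi>" using hom by (simp add: homeomorphism_def)
        \<comment> \<open>The old parameters must stay within \<open>e\<close> of \<open>t\<close>
          for the Lipschitz bound on \<open>\<gamma>\<close> and within 1 for
          \<open>abs_diff_le_arctan\<close>.\<close>
        then obtain \<delta> where \<delta>: "\<delta> > 0"
          "\<And>v. \<lbrakk>v \<in> \<phi> ` I; dist v u < \<delta>\<rbrakk> \<Longrightarrow> dist (\<psi> v) (\<psi> u) < min e 1"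
          unfolding continuous_on_iff
          using t e(1) by (elim ballE[of _ _ u] allE[of _ "min e 1"]) auto
        \<comment> \<open>The bound \<open>b - u\<close> keeps the endpoint out of the ball.\<close>
        define r where "r = min \<delta> (b - u)"
        \<comment> \<open>The local Lipschitz constant of the inverse of \<open>arctan\<close>;
          together with the constant \<open>B\<close> of \<open>\<gamma>\<close> it gives
          \<open>B * M\<close> for the extended curve.\<close>
        define M where "M = 1 + (\<bar>t\<bar> + 1)\<^sup>2"
        have "M > 0" unfolding M_def by (simp add: add_pos_nonneg)
        have pre: "\<exists>s\<in>I. x = \<phi> s \<and> \<bar>s - t\<bar> < e \<and> \<bar>s - t\<bar> < 1" if x: "x \<in> J \<inter> ball u r" for x
        proof -
          have "x \<noteq> b" using x by (auto simp: r_def dist_real_def)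
          then obtain s where s: "s \<in> I" "x = \<phi> s" using x by (auto simp: J_def)
          have "dist (\<psi> x) (\<psi> u) < min e 1"
            using x s by (intro \<delta>(2)) (auto simp: r_def dist_commute)
          then show ?thesis using s t \<psi> by (auto simp: dist_real_def)
        qed
        have "mdist \<rho> (\<gamma>' x) (\<gamma>' y) \<le> B * M * \<bar>x - y\<bar>"
          if xy: "x \<in> J \<inter> ball u r" "y \<in> J \<inter> ball u r" for x y
        proof -
          obtain s where s: "s \<in> I" "x = \<phi> s" "\<bar>s - t\<bar> < e" "\<bar>s - t\<bar> < 1"
            using pre[OF xy(1)] by blast
          obtain s' where s': "s' \<in> I" "y = \<phi> s'" "\<bar>s' - t\<bar> < e" "\<bar>s' - t\<bar> < 1"
            using pre[OF xy(2)] by blast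
          have "mdist \<rho> (\<gamma>' x) (\<gamma>' y) \<le> B * \<bar>s - s'\<bar>"
            using B(2)[of s s'] s s' \<gamma>'_\<phi> by (simp add: dist_real_def abs_minus_commute)
          also have "\<dots> \<le> B * (M * \<bar>arctan s - arctan s'\<bar>)"
            using B(1) s s' unfolding M_def by (intro mult_left_mono abs_diff_le_arctan) auto
          also have "\<dots> \<le> B * (M * \<bar>x - y\<bar>)"
          proof (intro mult_left_mono)
            show "\<bar>arctan s - arctan s'\<bar> \<le> \<bar>x - y\<bar>"
              using arctan_le[of s s'] arctan_le[of s' s] arctan_le_iff[of s s'] arctan_le_iff[of s' s] s s'
              by (cases "s \<le> s'") auto
          qed (use B(1) \<open>M > 0\<close> in auto)
          finally show ?thesis by (simp add: mult.assoc)
        qed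
        moreover have "B * M > 0" using B(1) \<open>M > 0\<close> by simp
        moreover have "\<gamma>' ` (J \<inter> ball u r) \<subseteq> mspace \<rho>" by (intro \<gamma>'_top) auto
        moreover have "r > 0" using \<delta>(1) less_b[OF t(1)] t by (simp add: r_def)
        ultimately show ?thesis
          unfolding Lipschitz_continuous_map_real_iff
          by (intro exI[of _ r] exI[of _ "B * M"] conjI ballI)
      qed
    qed
  qed (fact causal sup p bdd | use p(1) in simp)+
qed

end

section \<open>The future half of Condition B for both classes of curves, and the conclusion\<close>

lemma future_condition_B_continuous_curve:
  assumes ts: "time_separation (topspace T) l" and simple: "causally_simple T l"
    and complete: "timelike_Cauchy_complete T l"
  shows "future_condition_B (continuous_curve T) l"
  unfolding future_condition_B_def
proof (intro allI impI, elim conjE bexE exE)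
  fix I \<gamma> t0 C
  assume timelike: "timelike_curve (continuous_curve T) l I \<gamma>"
    and inextendible: "\<not> future_extendible (continuous_curve T) l I \<gamma>" and t0: "t0 \<in> I"
    and "\<forall>s\<in>{t0..} \<inter> I. lor_dist l (\<gamma> t0) (\<gamma> s) \<le> ereal C"
  then have bound: "\<And>s. \<lbrakk>s \<in> I; t0 \<le> s\<rbrakk> \<Longrightarrow> lor_dist l (\<gamma> t0) (\<gamma> s) \<le> ereal C" by simp
  have curve: "continuous_curve T I \<gamma>"
    and chron: "\<And>t s. \<lbrakk>t \<in> I; s \<in> I; t < s\<rbrakk> \<Longrightarrow> chron_rel l (\<gamma> t) (\<gamma> s)"
    using timelike by (simp_all add: timelike_curve_def)
  have \<gamma>: "\<gamma> t \<in> topspace T" if "t \<in> I" for t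
    using curve that by (auto simp: continuous_curve_def continuous_map_def Pi_iff)
  show "Sup (ereal ` I) \<in> ereal ` I"
  proof (rule ccontr)
    assume sup: "Sup (ereal ` I) \<notin> ereal ` I"
    have "\<exists>p\<in>topspace T. (\<forall>t\<in>I. causal_rel l (\<gamma> t) p) \<and>
      (\<forall>U. openin T U \<and> p \<in> U \<longrightarrow> (\<exists>t1\<in>I. \<forall>t\<in>I. t1 \<le> t \<longrightarrow> \<gamma> t \<in> U))"
      by (rule timelike_curve_endpoint) (fact ts simple complete \<gamma> chron t0 bound sup)+
    then obtain p where p: "p \<in> topspace T" "\<forall>t\<in>I. causal_rel l (\<gamma> t) p"
      "\<forall>U. openin T U \<and> p \<in> U \<longrightarrow> (\<exists>t1\<in>I. \<forall>t\<in>I. t1 \<le> t \<longrightarrow> \<gamma> t \<in> U)"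
      by (elim bexE conjE) (rule that)
    have "future_extendible (continuous_curve T) l I \<gamma>"
      by (rule future_extendible_continuous_curve)
        (fact curve causal_rel_if_chron_rel[OF chron] sup p(1) p(2)[rule_format]
          p(3)[rule_format, OF conjI])+
    with inextendible show False ..
  qed
qed

text \<open>Metric compatibility speaks only of curves that lie wholly in a neighbourhood, so it has
  to be applied to a final segment of \<open>\<gamma>\<close>.\<close>

lemma lipschitz_curve_atLeast:
  assumes "lipschitz_curve \<rho> I \<gamma>" "t1 \<in> I"
  shows "lipschitz_curve \<rho> (I \<inter> {t1..}) \<gamma>"
  unfolding lipschitz_curve_def continuous_curve_def
proof (intro conjI ballI)
  show "is_interval (I \<inter> {t1..})"
    using assms by (simp add: lipschitz_curve_def continuous_curve_def is_interval_Int)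
  show "I \<inter> {t1..} \<noteq> {}" using assms(2) by auto
  have "continuous_map (top_of_set I) (mtopology_of \<rho>) \<gamma>"
    using assms by (simp add: lipschitz_curve_def continuous_curve_def)
  then show "continuous_map (top_of_set (I \<inter> {t1..})) (mtopology_of \<rho>) \<gamma>"
    by (rule continuous_map_from_subtopology_mono) simp
  fix t assume "t \<in> I \<inter> {t1..}"
  then obtain e where "e > 0"
    and "Lipschitz_continuous_map (submetric euclidean_metric (I \<inter> ball t e)) \<rho> \<gamma>"
    using assms(1) by (auto simp: lipschitz_curve_def)
  moreover from this(2)
  have "Lipschitz_continuous_map (submetric euclidean_metric (I \<inter> {t1..} \<inter> ball t e)) \<rho> \<gamma>"
    by (rule Lipschitz_continuous_map_from_submetric_mono) auto
  ultimately show "\<exists>e>0. Lipschitz_continuous_map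
      (submetric euclidean_metric (I \<inter> {t1..} \<inter> ball t e)) \<rho> \<gamma>" by blast
qed

lemma future_condition_B_lipschitz_curve:
  assumes ts: "time_separation (mspace \<rho>) l" and simple: "causally_simple (mtopology_of \<rho>) l"
    and complete: "timelike_Cauchy_complete (mtopology_of \<rho>) l"
    and compat: "metric_compatible \<rho> l"
  shows "future_condition_B (lipschitz_curve \<rho>) l"
  unfolding future_condition_B_def
proof (intro allI impI, elim conjE bexE exE)
  fix I \<gamma> t0 D
  assume timelike: "timelike_curve (lipschitz_curve \<rho>) l I \<gamma>"
    and inextendible: "\<not> future_extendible (lipschitz_curve \<rho>) l I \<gamma>" and t0: "t0 \<in> I"
    and "\<forall>s\<in>{t0..} \<inter> I. lor_dist l (\<gamma> t0) (\<gamma> s) \<le> ereal D"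
  then have bound: "\<And>s. \<lbrakk>s \<in> I; t0 \<le> s\<rbrakk> \<Longrightarrow> lor_dist l (\<gamma> t0) (\<gamma> s) \<le> ereal D" by simp
  have curve: "lipschitz_curve \<rho> I \<gamma>"
    and chron: "\<And>t s. \<lbrakk>t \<in> I; s \<in> I; t < s\<rbrakk> \<Longrightarrow> chron_rel l (\<gamma> t) (\<gamma> s)"
    using timelike by (simp_all add: timelike_curve_def)
  have \<gamma>: "\<gamma> t \<in> mspace \<rho>" if "t \<in> I" for t
    using curve that by (auto simp: lipschitz_curve_def continuous_curve_def continuous_map_def Pi_iff)
  note causal = causal_rel_if_chron_rel[OF chron]
  show "Sup (ereal ` I) \<in> ereal ` I"
  proof (rule ccontr)
    assume sup: "Sup (ereal ` I) \<notin> ereal ` I"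
    have "\<exists>p\<in>topspace (mtopology_of \<rho>). (\<forall>t\<in>I. causal_rel l (\<gamma> t) p) \<and>
      (\<forall>U. openin (mtopology_of \<rho>) U \<and> p \<in> U \<longrightarrow> (\<exists>t1\<in>I. \<forall>t\<in>I. t1 \<le> t \<longrightarrow> \<gamma> t \<in> U))"
      by (rule timelike_curve_endpoint, unfold topspace_mtopology_of)
        (fact ts simple complete \<gamma> chron t0 bound sup)+
    then obtain p where p: "p \<in> topspace (mtopology_of \<rho>)" "\<forall>t\<in>I. causal_rel l (\<gamma> t) p"
      "\<forall>U. openin (mtopology_of \<rho>) U \<and> p \<in> U \<longrightarrow> (\<exists>t1\<in>I. \<forall>t\<in>I. t1 \<le> t \<longrightarrow> \<gamma> t \<in> U)"
      by (elim bexE conjE) (rule that)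
    obtain U W C where U: "openin (mtopology_of \<rho>) W" "p \<in> W" "W \<subseteq> U"
      and C: "\<forall>I \<gamma>. causal_curve (lipschitz_curve \<rho>) l I \<gamma> \<and> \<gamma> ` I \<subseteq> U
        \<longrightarrow> arclength \<rho> I \<gamma> \<le> ereal C"
      by (rule metric_compatibleE[OF compat p(1)[unfolded topspace_mtopology_of]])
    \<comment> \<open>Convergence to \<open>p\<close> traps the curve in \<open>W\<close> from
      \<open>t1\<close> on; the arclength bound \<open>C\<close> then holds for this final
      segment.\<close>
    obtain t1 where t1: "t1 \<in> I" "\<forall>t\<in>I. t1 \<le> t \<longrightarrow> \<gamma> t \<in> W" using p(3) U(1,2) by blast
    have arclength: "arclength \<rho> (I \<inter> {t1..}) \<gamma> \<le> ereal C"
    proof (rule C[rule_format, OF conjI])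
      show "causal_curve (lipschitz_curve \<rho>) l (I \<inter> {t1..}) \<gamma>"
        using lipschitz_curve_atLeast[OF curve t1(1)] causal by (simp add: causal_curve_def)
      show "\<gamma> ` (I \<inter> {t1..}) \<subseteq> U" using t1(2) U(3) by auto
    qed
    interpret rectifiable \<rho> \<gamma> "I \<inter> {t1..}" C
    proof
      fix ts assume "sorted ts" "set ts \<subseteq> I \<inter> {t1..}"
      then have "ereal (polygon_length \<rho> \<gamma> ts) \<le> ereal C"
        by (rule order_trans[OF polygon_length_le_arclength arclength])
      then show "polygon_length \<rho> \<gamma> ts \<le> C" by simp
    qed (use \<gamma> in auto)
    have "future_extendible (lipschitz_curve \<rho>) l I \<gamma>"
      by (rule future_extendible_lipschitz_curve[OF refl])
        (fact t1(1) curve causal sup p(1)[unfolded topspace_mtopology_of] p(2)[rule_format]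
          p(3)[rule_format, OF conjI])+
    with inextendible show False ..
  qed
qed

theorem proposition4p6:
  fixes T :: "'a topology" and l :: "'a \<Rightarrow> 'a \<Rightarrow> ereal"
  assumes "causally_simple T l"
    and "timelike_Cauchy_complete T l"
  shows "(lorentzian_pre_length_space T l \<and> first_countable T
            \<longrightarrow> condition_B (continuous_curve T) l) \<and>
         (\<forall>\<rho>. KS_lorentzian_pre_length_space T \<rho> l \<and> metric_compatible \<rho> l
            \<longrightarrow> condition_B (lipschitz_curve \<rho>) l)"
proof (intro conjI allI impI)
  assume "lorentzian_pre_length_space T l \<and> first_countable T"
  then have ts: "time_separation (topspace T) l" by (simp add: lorentzian_pre_length_space_def)
  show "condition_B (continuous_curve T) l"
  proof (rule condition_B_if_future_condition_B)
    show "future_condition_B (continuous_curve T) l"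
      using ts assms by (rule future_condition_B_continuous_curve)
    show "future_condition_B (continuous_curve T) (\<lambda>x y. l y x)"
      using time_separation_reverse[OF ts] causally_simple_reverse[OF assms(1)]
        timelike_Cauchy_complete_reverse[OF assms(2)]
      by (rule future_condition_B_continuous_curve)
  qed (rule continuous_curve_reflect)
next
  fix \<rho> assume asm: "KS_lorentzian_pre_length_space T \<rho> l \<and> metric_compatible \<rho> l"
  then have T: "mtopology_of \<rho> = T" and compat: "metric_compatible \<rho> l"
    and "time_separation (topspace T) l"
    by (auto simp: KS_lorentzian_pre_length_space_def lorentzian_pre_length_space_def)
  then have ts: "time_separation (mspace \<rho>) l" by auto
  \<comment> \<open>The Lipschitz results are stated for the topology of \<open>\<rho>\<close>, so
    \<open>T\<close> is rewritten to \<open>mtopology_of \<rho>\<close>.\<close>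
  note simple = assms(1)[folded T] and complete = assms(2)[folded T]
  show "condition_B (lipschitz_curve \<rho>) l"
  proof (rule condition_B_if_future_condition_B)
    show "future_condition_B (lipschitz_curve \<rho>) l"
      using ts simple complete compat by (rule future_condition_B_lipschitz_curve)
    show "future_condition_B (lipschitz_curve \<rho>) (\<lambda>x y. l y x)"
      using time_separation_reverse[OF ts] causally_simple_reverse[OF simple]
        timelike_Cauchy_complete_reverse[OF complete] metric_compatible_reverse[OF compat]
      by (rule future_condition_B_lipschitz_curve)
  qed (rule lipschitz_curve_reflect)
qed

end
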